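(* Let $A$ be one of the algebras $\mathbb{C}$ (complex numbers), $\mathbb{C}^1$ (double numbers), $\mathbb{C}^0$ (dual numbers), and let $AP^2$ be the projective plane over $A$. Assigning to each point $X\in AP^2$, represented by a real $(6\times 2)$-matrix with columns $x_0,x_1$, the straight line $x_0\wedge x_1$ of the real projective space $\mathbb{R}P^5$ gives bijective mappings of the projective planes $\mathbb{C}P^2$, $\mathbb{C}^1P^2$ and $\mathbb{C}^0P^2$ onto linear congruences $K$, $K^1$ and $K^0$, respectively, of $\mathbb{R}P^5$. The congruence $K$ is elliptic, the congruence $K^1$ is hyperbolic, and the congruence $K^0$ is parabolic.
   Context: **Algebras.** $\mathbb{C}=\{x+iy\}$ with $i^2=-1$, $\mathbb{C}^1=\{x+ey\}$ with $e^2=1$, $\mathbb{C}^0=\{x+\varepsilon y\}$ with $\varepsilon^2=0$, where $x,y\in\mathbb{R}$. They are identified with algebras of real $(2\times 2)$-matrices by $$x+iy\mapsto\begin{pmatrix}x&-y\\ y&x\end{pmatrix},\qquad x+ey\mapsto\begin{pmatrix}x&y\\ y&x\end{pmatrix},\qquad x+\varepsilon y\mapsto\begin{pmatrix}x&0\\ y&x\end{pmatrix}.$$ **Projective plane $AP^2$.** A point $X\in AP^2$ is given by three coordinates $X^0,X^1,X^2\in A$, written as a column $X=(X^0,X^1,X^2)^T$, which in the matrix representation is a real $(6\times2)$-matrix; its two columns $x_0,x_1\in\mathbb{R}^6$ are required to be linearly independent. The coordinates are defined up to simultaneous multiplication from the right by an element $P\in A$ which is not a zero divisor (i.e. an invertible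 element). The columns are regarded as points of $\mathbb{R}P^5$, and $x_0\wedge x_1$ denotes the straight line through them. **Congruences.** A congruence in $\mathbb{R}P^5$ is a family of straight lines depending on 4 real parameters (a 4-dimensional submanifold of the Grassmannian $G(1,5)$ of straight lines of $\mathbb{R}P^5$). $K$, $K^1$, $K^0$ denote the families of all lines $x_0\wedge x_1$ obtained from the points of $\mathbb{C}P^2$, $\mathbb{C}^1P^2$, $\mathbb{C}^0P^2$, respectively. **Foci.** Let $\mathcal{K}$ be a congruence and $L\in\mathcal{K}$ a line, with $\hat L\subset\mathbb{R}^6$ the corresponding 2-dimensional subspace. Each tangent vector of $\mathcal{K}$ at $L$ is a linear map $\varphi:\hat L\to\mathbb{R}^6/\hat L$. A (real or complex) point $[v]$ of $L$ is a focus (singular point) of $L$ if some nonzero (real or complex, respectively) tangent vector $\varphi$ satisfies $\varphi(v)=0$; equivalently, for some infinitesimal displacement of $L$ in $\mathcal{K}$ the differential of the point belongs to $L$. The multiplicity of the focus is its multiplicity as a zero of the degree-4 form $v\mapsto\det(\varphi\mapsto\varphi(v))$, where $\varphi$ ranges over the 4-dimensional tangent space $T_L\mathcal{K}$ and $\varphi(v)\in\mathbb{R}^6/\hat L$. **Types of linear congruences.** The congruence is called linear because its foci fill fixed planes, according to one of the following types: - hyperbolic: every line carries exactly two foci, both real and of multiplicity two, and these foci describe two fixed real 2-planes $\pi_1,\pi_2\subset\mathbb{R}P^5$ in general position (disjoint), so that the congruence is the family of straight lines meeting both $\pi_1$ and $\pi_2$; - elliptic: every line carries exactly two foci, complex conjugate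 and each of multiplicity two, and these foci describe two complex conjugate 2-planes $\pi_1$ and $\pi_2=\overline{\pi}_1$ of $\mathbb{C}P^5$ in general position; - parabolic: every line carries exactly one focus, real and of multiplicity four, and these foci describe one fixed real 2-plane $\pi\subset\mathbb{R}P^5$. *)

theory Defs
  imports "HOL-Analysis.Analysis" "HOL-Computational_Algebra.Polynomial"
begin

section \<open>The three algebras and their matrix representations\<close>

text \<open>\<open>DoubleN x y\<close> is \<open>x + e y\<close> with \<open>e\<^sup>2 = 1\<close>, and \<open>DualN x y\<close> is
  \<open>x + \<epsilon> y\<close> with \<open>\<epsilon>\<^sup>2 = 0\<close>.\<close>

datatype double_num = DoubleN (db_re: real) (db_im: real)
datatype dual_num = DualN (du_re: real) (du_im: real)

instantiation double_num :: comm_ring_1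
begin
definition "0 = DoubleN 0 0"
definition "1 = DoubleN 1 0"
definition "a + b = DoubleN (db_re a + db_re b) (db_im a + db_im b)"
definition "a - b = DoubleN (db_re a - db_re b) (db_im a - db_im b)"
definition "- a = DoubleN (- db_re a) (- db_im a)"
definition "a * b = DoubleN (db_re a * db_re b + db_im a * db_im b)
                            (db_re a * db_im b + db_im a * db_re b)"
instance
  by standard (simp_all add: zero_double_num_def one_double_num_def plus_double_num_def
      minus_double_num_def uminus_double_num_def times_double_num_def algebra_simps)
end

instantiation dual_num :: comm_ring_1
begin
definition "0 = DualN 0 0"
definition "1 = DualN 1 0"
definition "a + b = DualN (du_re a + du_re b) (du_im a + du_im b)"
definition "a - b = DualN (du_re a - du_re b) (du_im a - du_im b)"
definition "- a = DualN (- du_re a) (- du_im a)"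
definition "a * b = DualN (du_re a * du_re b) (du_re a * du_im b + du_im a * du_re b)"
instance
  by standard (simp_all add: zero_dual_num_def one_dual_num_def plus_dual_num_def
      minus_dual_num_def uminus_dual_num_def times_dual_num_def algebra_simps)
end

definition complex_mat :: "complex \<Rightarrow> real^2^2" where
  "complex_mat z = vector [vector [Re z, - Im z], vector [Im z, Re z]]"

definition double_mat :: "double_num \<Rightarrow> real^2^2" where
  "double_mat z = vector [vector [db_re z, db_im z], vector [db_im z, db_re z]]"

definition dual_mat :: "dual_num \<Rightarrow> real^2^2" where
  "dual_mat z = vector [vector [du_re z, 0], vector [du_im z, du_re z]]"

lemma complex_mat_mult: "complex_mat (a * b) = complex_mat a ** complex_mat b"
  by (simp add: complex_mat_def matrix_matrix_mult_def vec_eq_iff forall_2 sum_2)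

lemma double_mat_mult: "double_mat (a * b) = double_mat a ** double_mat b"
  by (simp add: double_mat_def times_double_num_def matrix_matrix_mult_def vec_eq_iff
      forall_2 sum_2)

lemma dual_mat_mult: "dual_mat (a * b) = dual_mat a ** dual_mat b"
  by (simp add: dual_mat_def times_dual_num_def matrix_matrix_mult_def vec_eq_iff
      forall_2 sum_2)

section \<open>The projective plane over an algebra\<close>

text \<open>Coordinates of \<open>\<real>\<^sup>6\<close> are indexed by \<open>3 \<times> 2\<close>: the index \<open>(k, i)\<close> is row \<open>i\<close> of the
  \<open>k\<close>-th \<open>2 \<times> 2\<close> block.  Points of projective space are 1-dimensional and
  lines are 2-dimensional linear subspaces.  The parameter \<open>\<rho>\<close> is the matrix representation
  of the algebra.\<close>

type_synonym R6 = "real^(3 \<times> 2)"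
type_synonym C6 = "complex^(3 \<times> 2)"

definition point_mat :: "('a \<Rightarrow> real^2^2) \<Rightarrow> 'a^3 \<Rightarrow> real^2^(3 \<times> 2)" where
  "point_mat \<rho> X = (\<chi> r c. \<rho> (X $ fst r) $ snd r $ c)"

definition point_reps :: "('a \<Rightarrow> real^2^2) \<Rightarrow> ('a^3) set" where
  "point_reps \<rho> = {X. column 1 (point_mat \<rho> X) \<noteq> column 2 (point_mat \<rho> X) \<and>
     independent {column 1 (point_mat \<rho> X), column 2 (point_mat \<rho> X)}}"

definition nonzero_divisor :: "'a::comm_ring_1 \<Rightarrow> bool" where
  "nonzero_divisor P \<longleftrightarrow> (\<forall>Q. Q * P = 0 \<longrightarrow> Q = 0)"

definition point_rel :: "('a::comm_ring_1 \<Rightarrow> real^2^2) \<Rightarrow> (('a^3) \<times> ('a^3)) set" where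
  "point_rel \<rho> = {(X, Y). X \<in> point_reps \<rho> \<and> Y \<in> point_reps \<rho> \<and>
     (\<exists>P. nonzero_divisor P \<and> Y = (\<chi> k. X $ k * P))}"

definition proj_plane :: "('a::comm_ring_1 \<Rightarrow> real^2^2) \<Rightarrow> ('a^3) set set" where
  "proj_plane \<rho> = point_reps \<rho> // point_rel \<rho>"

definition column_line :: "('a \<Rightarrow> real^2^2) \<Rightarrow> 'a^3 \<Rightarrow> R6 set" where
  "column_line \<rho> X = span {column 1 (point_mat \<rho> X), column 2 (point_mat \<rho> X)}"

text \<open>The line of a point; \<open>the_elem\<close> is meaningful if \<open>column_line \<rho>\<close> respects \<open>point_rel \<rho>\<close>.\<close>

definition point_line :: "('a \<Rightarrow> real^2^2) \<Rightarrow> ('a^3) set \<Rightarrow> R6 set" where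
  "point_line \<rho> x = the_elem (column_line \<rho> ` x)"

definition line_family :: "('a \<Rightarrow> real^2^2) \<Rightarrow> R6 set set" where
  "line_family \<rho> = column_line \<rho> ` point_reps \<rho>"

section \<open>Four-dimensional submanifolds of the Grassmannian of lines\<close>

definition lines :: "R6 set set" where
  "lines = {L. subspace L \<and> dim L = 2}"

text \<open>The quotient topology of the space of pairs of linearly independent vectors.\<close>

definition grassmannian :: "R6 set topology" where
  "grassmannian = topology (\<lambda>N. N \<subseteq> lines \<and> open {(x, y). span {x, y} \<in> N})"

lemma openin_grassmannian:
  "openin grassmannian N \<longleftrightarrow> N \<subseteq> lines \<and> open {(x, y). span {x, y} \<in> N}"
proof -
  have "istopology (\<lambda>N. N \<subseteq> lines \<and> open {(x, y). span {x, y} \<in> N})"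
    unfolding istopology_def
  proof (intro conjI allI impI)
    fix S T :: "R6 set set"
    assume "S \<subseteq> lines \<and> open {(x, y). span {x, y} \<in> S}"
      and "T \<subseteq> lines \<and> open {(x, y). span {x, y} \<in> T}"
    moreover have "{(x, y). span {x, y} \<in> S \<inter> T} =
        {(x, y). span {x, y} \<in> S} \<inter> {(x, y). span {x, y} \<in> T}"
      by auto
    ultimately show "S \<inter> T \<subseteq> lines" "open {(x, y). span {x, y} \<in> S \<inter> T}"
      by (auto intro: open_Int)
  next
    fix \<N> :: "R6 set set set"
    assume *: "\<forall>N\<in>\<N>. N \<subseteq> lines \<and> open {(x, y). span {x, y} \<in> N}"
    then show "\<Union>\<N> \<subseteq> lines" by blast
    have "{(x, y). span {x, y} \<in> \<Union>\<N>} = (\<Union>N\<in>\<N>. {(x, y). span {x, y} \<in> N})"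
      by auto
    with * show "open {(x, y). span {x, y} \<in> \<Union>\<N>}"
      by (metis (no_types, lifting) open_UN)
  qed
  then show ?thesis
    by (simp add: grassmannian_def topology_inverse')
qed

text \<open>Smoothness (of class \<open>C\<^sup>\<infinity>\<close>) on an open set: all iterated directional derivatives
  exist and are again differentiable.\<close>

coinductive smooth_on :: "'a::euclidean_space set \<Rightarrow> ('a \<Rightarrow> 'b::real_normed_vector) \<Rightarrow> bool"
  for U :: "'a set" where
  "\<lbrakk>\<And>x. x \<in> U \<Longrightarrow> (f has_derivative f' x) (at x); \<And>h. smooth_on U (\<lambda>x. f' x h)\<rbrakk>
    \<Longrightarrow> smooth_on U f"

text \<open>An embedded 4-dimensional submanifold, given by local parametrizations
  \<open>u \<mapsto> a(u) \<and> b(u)\<close>.  The last condition says that this map is an immersion: its derivative in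
  direction \<open>h\<close> is the map from the line \<open>L\<close> to \<open>\<real>\<^sup>6 / L\<close> that sends \<open>a(u)\<close> and \<open>b(u)\<close> to the
  classes of their derivatives.\<close>

definition congruence :: "R6 set set \<Rightarrow> bool" where
  "congruence K \<longleftrightarrow> K \<subseteq> lines \<and>
     (\<forall>L\<in>K. \<exists>(U :: (real^4) set) a b.
        open U \<and> smooth_on U a \<and> smooth_on U b \<and>
        L \<in> (\<lambda>u. span {a u, b u}) ` U \<and>
        openin (subtopology grassmannian K) ((\<lambda>u. span {a u, b u}) ` U) \<and>
        embedding_map (top_of_set U) grassmannian (\<lambda>u. span {a u, b u}) \<and>
        (\<forall>u\<in>U. \<forall>h. h \<noteq> 0 \<longrightarrow>
           \<not> (frechet_derivative a (at u) h \<in> span {a u, b u} \<and>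
              frechet_derivative b (at u) h \<in> span {a u, b u})))"

section \<open>Tangent vectors and foci\<close>

text \<open>The quotient \<open>\<real>\<^sup>6 / L\<close> is realized as the orthogonal complement of \<open>L\<close>, so that a linear map
  from \<open>L\<close> to \<open>\<real>\<^sup>6 / L\<close> is a matrix that vanishes on \<open>L\<^sup>\<bottom>\<close> and takes values in \<open>L\<^sup>\<bottom>\<close>.
  It is tangent to \<open>K\<close> if it is the velocity of a smooth curve \<open>t \<mapsto> a(t) \<and> b(t)\<close> in \<open>K\<close>,
  that is, if it sends \<open>a(0)\<close> and \<open>b(0)\<close> to the classes of \<open>a'(0)\<close> and \<open>b'(0)\<close> modulo \<open>L\<close>.\<close>

definition tangent_space :: "R6 set set \<Rightarrow> R6 set \<Rightarrow> (real^(3 \<times> 2)^(3 \<times> 2)) set" where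
  "tangent_space K L = {\<phi>. (\<forall>x\<in>L\<^sup>\<bottom>. \<phi> *v x = 0) \<and> (\<forall>x. \<phi> *v x \<in> L\<^sup>\<bottom>) \<and>
     (\<exists>\<delta>>0. \<exists>a b :: real \<Rightarrow> R6.
        smooth_on {-\<delta><..<\<delta>} a \<and> smooth_on {-\<delta><..<\<delta>} b \<and>
        (\<forall>t\<in>{-\<delta><..<\<delta>}. span {a t, b t} \<in> K) \<and> span {a 0, b 0} = L \<and>
        vector_derivative a (at 0) - \<phi> *v a 0 \<in> L \<and>
        vector_derivative b (at 0) - \<phi> *v b 0 \<in> L)}"

definition cplx :: "(real^'n) set \<Rightarrow> (complex^'n) set" where
  "cplx S = {v. (\<chi> i. Re (v $ i)) \<in> S \<and> (\<chi> i. Im (v $ i)) \<in> S}"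

definition cplx_mats :: "(real^'n^'m) set \<Rightarrow> (complex^'n^'m) set" where
  "cplx_mats S = {M. map_matrix Re M \<in> S \<and> map_matrix Im M \<in> S}"

text \<open>The points of the projective subspace given by a linear subspace.  For a real
  point \<open>p\<close>, the same point of \<open>\<complex>P\<^sup>5\<close> is \<open>cplx p\<close>.\<close>

definition real_points :: "R6 set \<Rightarrow> R6 set set" where
  "real_points S = {span {v} | v. v \<in> S \<and> v \<noteq> 0}"

definition complex_points :: "C6 set \<Rightarrow> C6 set set" where
  "complex_points S = {vec.span {v} | v. v \<in> S \<and> v \<noteq> 0}"

definition real_foci :: "R6 set set \<Rightarrow> R6 set \<Rightarrow> R6 set set" where
  "real_foci K L = {span {v} | v. v \<in> L \<and> v \<noteq> 0 \<and>
     (\<exists>\<phi>\<in>tangent_space K L. \<phi> \<noteq> 0 \<and> \<phi> *v v = 0)}"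

definition complex_foci :: "R6 set set \<Rightarrow> R6 set \<Rightarrow> C6 set set" where
  "complex_foci K L = {vec.span {v} | v. v \<in> cplx L \<and> v \<noteq> 0 \<and>
     (\<exists>\<phi>\<in>cplx_mats (tangent_space K L). \<phi> \<noteq> 0 \<and> \<phi> *v v = 0)}"

text \<open>The form \<open>v \<mapsto> det (\<phi> \<mapsto> \<phi>(v))\<close> in terms of a basis \<open>B\<close> of the tangent space and a
  basis \<open>C\<close> of \<open>L\<^sup>\<bottom>\<close>, regarded as coordinate functionals on \<open>\<real>\<^sup>6 / L\<close>.  A change of
  bases multiplies it by a nonzero constant.\<close>

definition focal_form ::
  "(4 \<Rightarrow> real^(3 \<times> 2)^(3 \<times> 2)) \<Rightarrow> (4 \<Rightarrow> R6) \<Rightarrow> C6 \<Rightarrow> complex" where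
  "focal_form B C v =
     det (\<chi> i j. \<Sum>k\<in>UNIV. of_real (C i $ k) * (map_matrix of_real (B j) *v v) $ k)"

definition basis_of :: "('i \<Rightarrow> 'v::real_vector) \<Rightarrow> 'v set \<Rightarrow> bool" where
  "basis_of B S \<longleftrightarrow> inj B \<and> independent (range B) \<and> span (range B) = S"

text \<open>The point \<open>[v]\<close> of \<open>L\<close> is a zero of multiplicity \<open>m\<close> of the binary form \<open>F\<close> if
  the polynomial \<open>F(v + t w)\<close> in \<open>t\<close> has a zero of order \<open>m\<close> at \<open>0\<close>, for \<open>w\<close> in \<open>L\<close>
  not proportional to \<open>v\<close>.\<close>

definition focus_multiplicity :: "R6 set set \<Rightarrow> R6 set \<Rightarrow> C6 set \<Rightarrow> nat \<Rightarrow> bool" where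
  "focus_multiplicity K L p m \<longleftrightarrow>
     (\<exists>B C v w F. basis_of B (tangent_space K L) \<and> basis_of C (L\<^sup>\<bottom>) \<and>
        v \<in> cplx L \<and> v \<noteq> 0 \<and> p = vec.span {v} \<and> w \<in> cplx L \<and> w \<notin> vec.span {v} \<and>
        (\<forall>t. poly F t = focal_form B C (v + t *s w)) \<and> F \<noteq> 0 \<and> order 0 F = m)"

section \<open>Types of linear congruences\<close>

definition conj_set :: "C6 set \<Rightarrow> C6 set" where
  "conj_set S = (\<lambda>v. \<chi> i. cnj (v $ i)) ` S"

definition hyperbolic :: "R6 set set \<Rightarrow> bool" where
  "hyperbolic K \<longleftrightarrow> congruence K \<and>
     (\<exists>\<pi>\<^sub>1 \<pi>\<^sub>2. subspace \<pi>\<^sub>1 \<and> dim \<pi>\<^sub>1 = 3 \<and> subspace \<pi>\<^sub>2 \<and> dim \<pi>\<^sub>2 = 3 \<and> \<pi>\<^sub>1 \<inter> \<pi>\<^sub>2 = {0} \<and>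
        (\<forall>L\<in>K. \<exists>p q. p \<noteq> q \<and> real_foci K L = {p, q} \<and> complex_foci K L = {cplx p, cplx q} \<and>
           focus_multiplicity K L (cplx p) 2 \<and> focus_multiplicity K L (cplx q) 2 \<and>
           p \<subseteq> \<pi>\<^sub>1 \<and> q \<subseteq> \<pi>\<^sub>2) \<and>
        (\<Union>L\<in>K. real_foci K L) = real_points \<pi>\<^sub>1 \<union> real_points \<pi>\<^sub>2 \<and>
        K = {L \<in> lines. L \<inter> \<pi>\<^sub>1 \<noteq> {0} \<and> L \<inter> \<pi>\<^sub>2 \<noteq> {0}})"

definition elliptic :: "R6 set set \<Rightarrow> bool" where
  "elliptic K \<longleftrightarrow> congruence K \<and>
     (\<exists>\<pi>\<^sub>1 \<pi>\<^sub>2. vec.subspace \<pi>\<^sub>1 \<and> vec.dim \<pi>\<^sub>1 = 3 \<and> \<pi>\<^sub>2 = conj_set \<pi>\<^sub>1 \<and> \<pi>\<^sub>1 \<inter> \<pi>\<^sub>2 = {0} \<and>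
        (\<forall>L\<in>K. \<exists>p q. p \<noteq> q \<and> q = conj_set p \<and> real_foci K L = {} \<and> complex_foci K L = {p, q} \<and>
           focus_multiplicity K L p 2 \<and> focus_multiplicity K L q 2 \<and>
           p \<subseteq> \<pi>\<^sub>1 \<and> q \<subseteq> \<pi>\<^sub>2) \<and>
        (\<Union>L\<in>K. complex_foci K L) = complex_points \<pi>\<^sub>1 \<union> complex_points \<pi>\<^sub>2)"

definition parabolic :: "R6 set set \<Rightarrow> bool" where
  "parabolic K \<longleftrightarrow> congruence K \<and>
     (\<exists>\<pi>. subspace \<pi> \<and> dim \<pi> = 3 \<and>
        (\<forall>L\<in>K. \<exists>p. real_foci K L = {p} \<and> complex_foci K L = {cplx p} \<and>
           focus_multiplicity K L (cplx p) 4) \<and>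
        (\<Union>L\<in>K. real_foci K L) = real_points \<pi>)"

end

theory Submission
  imports Defs
begin

text \<open>Multiplication by the generator of \<open>A\<close> (\<open>i\<close>, \<open>e\<close> or \<open>\<epsilon>\<close>) is a real-linear operator \<open>T\<close> of
\<open>A\<^sup>3 = \<real>\<^sup>6\<close> with \<open>T\<^sup>2 = s\<close>, where \<open>s\<close> is \<open>-1\<close>, \<open>1\<close> or \<open>0\<close>.  If the first column of the matrix of a
point is \<open>x\<close>, then the second column is \<open>T x\<close>; so the line of the point is the \<open>A\<close>-submodule \<open>x A\<close>,
and the condition on points says that \<open>x\<close> generates a free submodule.  Almost everything can
therefore be done once, for an operator \<open>T\<close> with \<open>T\<^sup>2 = s\<close> such that \<open>\<real>\<^sup>6 / x A\<close> is again free over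
\<open>A = \<real>[T]\<close> whenever \<open>x A\<close> is (locale \<open>quadratic_operator\<close>), and the sign of \<open>s\<close> decides the type.

The map from points to lines is well defined and injective since two free generators \<open>x\<close>, \<open>y\<close> have
the same line iff \<open>y = x (p + q T)\<close>, and \<open>y\<close> is again a free generator iff the norm \<open>p\<^sup>2 - s q\<^sup>2\<close> of the
factor is nonzero (\<open>point_rel_iff\<close>).

Near a line \<open>L = x\<^sub>0 A\<close> every line of the congruence contains exactly one vector of the affine
4-space \<open>x\<^sub>0 + L\<^sup>\<bottom>\<close>, and this vector generates it.  These vectors are the coordinates of a chart
(\<open>chart_at_L\<close>).

Since all lines of the congruence are \<open>T\<close>-invariant, a tangent vector \<open>\<phi> : L \<rightarrow> \<real>\<^sup>6 / L\<close> commutes with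
\<open>T\<close>; conversely every \<open>A\<close>-linear \<open>\<phi>\<close> is tangent, and it is given by the value \<open>\<phi> x\<^sub>0\<close>, which is
arbitrary (\<open>tangent_space_eq\<close>).  At \<open>v = p x\<^sub>0 + q T x\<^sub>0\<close> the map \<open>\<phi> \<mapsto> \<phi> v\<close> becomes multiplication by
\<open>p + q T\<close> on the free module \<open>\<real>\<^sup>6 / L\<close> of rank 2, so the focal form is \<open>(p\<^sup>2 - s q\<^sup>2)\<^sup>2\<close> up to a constant
(\<open>focal_form_eq\<close>).  Its zeros are the eigenvectors \<open>r x\<^sub>0 + T x\<^sub>0\<close> of \<open>T\<close> with \<open>r\<^sup>2 = s\<close>: two double zeros
if \<open>s \<noteq> 0\<close>, real for \<open>s = 1\<close> and conjugate for \<open>s = -1\<close>, and one zero of multiplicity four if \<open>s = 0\<close>.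
The foci of all lines fill the projective planes of the eigenspaces of \<open>T\<close>, which are
3-dimensional.\<close>

section \<open>Planes spanned by two vectors\<close>

text \<open>The projective points and lines of the definitions are written with sets \<open>{x, y}\<close>, which hide the
case \<open>x = y\<close>; this coordinate form of independence does not.\<close>

definition lin_pair :: "'a::real_vector \<Rightarrow> 'a \<Rightarrow> bool" where
  "lin_pair x y \<longleftrightarrow> (\<forall>p q. p *\<^sub>R x + q *\<^sub>R y = 0 \<longrightarrow> p = 0 \<and> q = 0)"

lemma lin_pairD: "lin_pair x y \<Longrightarrow> p *\<^sub>R x + q *\<^sub>R y = 0 \<Longrightarrow> p = 0 \<and> q = 0"
  unfolding lin_pair_def by blast

lemma span_pair: "span {x, y} = {p *\<^sub>R x + q *\<^sub>R y | p q. True}"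
proof -
  have "v \<in> span {x, y} \<longleftrightarrow> (\<exists>p q. v = p *\<^sub>R x + q *\<^sub>R y)" for v
    unfolding span_insert[of x] span_singleton
    by (auto simp: image_iff algebra_simps)
  then show ?thesis by blast
qed

lemma in_span_pair: "p *\<^sub>R x + q *\<^sub>R y \<in> span {x, y}"
  by (auto simp: span_pair)

lemma in_span_pairE:
  assumes "v \<in> span {x, y}" obtains p q where "v = p *\<^sub>R x + q *\<^sub>R y"
  using assms by (auto simp: span_pair)

lemma lin_pair_iff_independent: "lin_pair x y \<longleftrightarrow> x \<noteq> y \<and> independent {x, y}"
proof
  assume l: "lin_pair x y"
  have "x \<noteq> y" using lin_pairD[OF l, of 1 "-1"] by auto
  moreover have "y \<noteq> 0" using lin_pairD[OF l, of 0 1] by auto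
  moreover have "x \<notin> span {y}"
  proof
    assume "x \<in> span {y}"
    then obtain k where "x = k *\<^sub>R y" by (auto simp: span_singleton)
    then show False using lin_pairD[OF l, of 1 "-k"] by auto
  qed
  ultimately show "x \<noteq> y \<and> independent {x, y}"
    by (simp add: independent_insert)
next
  assume i: "x \<noteq> y \<and> independent {x, y}"
  then have y: "y \<noteq> 0" and x: "x \<notin> span {y}"
    by (auto simp: independent_insert dependent_zero)
  show "lin_pair x y"
    unfolding lin_pair_def
  proof (intro allI impI)
    fix p q assume e: "p *\<^sub>R x + q *\<^sub>R y = 0"
    have "p = 0"
    proof (rule ccontr)
      assume "p \<noteq> 0"
      have "p *\<^sub>R x = (-q) *\<^sub>R y" using e by (simp add: eq_neg_iff_add_eq_0)
      then have "x = (-q/p) *\<^sub>R y" using \<open>p \<noteq> 0\<close>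
        by (metis (no_types) divide_inverse mult.commute scaleR_scaleR real_vector.scale_left_imp_eq scaleR_one left_inverse)
      then show False using x by (metis insertI1 span_base span_scale)
    qed
    then show "p = 0 \<and> q = 0" using e y by simp
  qed
qed

lemma dim_span_pair_iff: 
  fixes x :: "'a::euclidean_space"
  shows "dim (span {x, y}) = 2 \<longleftrightarrow> lin_pair x y"
proof
  assume "lin_pair x y"
  then show "dim (span {x, y}) = 2"
    by (simp add: lin_pair_iff_independent dim_eq_card_independent)
next
  assume d: "dim (span {x, y}) = 2"
  then have "x \<noteq> y"
    using dim_le_card'[of "{x}"] by auto
  moreover from this d have "independent {x, y}"
    by (intro card_le_dim_spanning[of _ "span {x, y}"]) (auto simp: span_base)
  ultimately show "lin_pair x y" by (simp add: lin_pair_iff_independent)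
qed

lemma span_pair_eq_subspace:
  fixes x :: "'a::euclidean_space"
  assumes "subspace L" "dim L = 2" "x \<in> L" "y \<in> L" "lin_pair x y"
  shows "span {x, y} = L"
  using assms dim_span_pair_iff[of x y] span_minimal[of "{x, y}" L]
  by (intro subspace_dim_equal) auto

lemma scaleR_memD: "subspace S \<Longrightarrow> c *\<^sub>R v \<in> S \<Longrightarrow> c \<noteq> 0 \<Longrightarrow> v \<in> S"
  using subspace_scale[of S "c *\<^sub>R v" "inverse c"] by simp

lemma exists_outside_span:
  fixes V :: "'a::euclidean_space set"
  assumes "finite B" "card B < dim V"
  shows "\<exists>v\<in>V. v \<notin> span B"
  using assms dim_le_card[of V B] by (meson leD subsetI)

text \<open>A line is too small to contain \<open>V\<close>, and so is the span of the line and one more vector; each of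
these dimension counts supplies one direction.\<close>

lemma exists_two_mod_line:
  fixes V :: "'a::euclidean_space set"
  assumes "3 \<le> dim V"
  obtains u v where "u \<in> V" "v \<in> V"
    "\<And>c d. c *\<^sub>R u + d *\<^sub>R v \<in> span {a} \<Longrightarrow> c = 0 \<and> d = 0"
proof -
  obtain u where u: "u \<in> V" "u \<notin> span {a}"
    using exists_outside_span[of "{a}" V] assms by auto
  have "card {a, u} < dim V"
    using assms card_insert_le_m1[of 2 "{u}" a] by simp
  then obtain v where v: "v \<in> V" "v \<notin> span {a, u}"
    using exists_outside_span[of "{a, u}" V] by auto
  have "c = 0 \<and> d = 0" if e: "c *\<^sub>R u + d *\<^sub>R v \<in> span {a}" for c d
  proof -
    obtain k where k: "c *\<^sub>R u + d *\<^sub>R v = k *\<^sub>R a" using e by (auto simp: span_singleton)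
    have "d = 0"
    proof (rule ccontr)
      assume "d \<noteq> 0"
      have "d *\<^sub>R v = k *\<^sub>R a + (-c) *\<^sub>R u" using k by (simp add: algebra_simps)
      then have "d *\<^sub>R v \<in> span {a, u}" using in_span_pair by metis
      then show False using v \<open>d \<noteq> 0\<close> scaleR_memD[OF subspace_span] by blast
    qed
    moreover have "c = 0"
      using e u \<open>d = 0\<close> scaleR_memD[OF subspace_span, of c u "{a}"] by auto
    ultimately show ?thesis by simp
  qed
  with u v that show ?thesis by blast
qed

section \<open>Invariant lines of an operator with scalar square\<close>

text \<open>If \<open>x\<close> and \<open>T x\<close> span a line in \<open>\<real>\<^sup>6\<close>, then the four independent vectors form a basis of the
quotient by this line for dimension reasons, so that the quotient is a free \<open>\<real>[T]\<close>-module of rank 2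
with basis \<open>u, v\<close>.\<close>

definition free_quotient :: "real^'n^'n \<Rightarrow> real^'n \<Rightarrow> bool" where
  "free_quotient T x \<longleftrightarrow> (\<exists>u v. \<forall>c\<^sub>1 c\<^sub>2 d\<^sub>1 d\<^sub>2.
    c\<^sub>1 *\<^sub>R u + c\<^sub>2 *\<^sub>R (T *v u) + d\<^sub>1 *\<^sub>R v + d\<^sub>2 *\<^sub>R (T *v v) \<in> span {x, T *v x} \<longrightarrow>
    c\<^sub>1 = 0 \<and> c\<^sub>2 = 0 \<and> d\<^sub>1 = 0 \<and> d\<^sub>2 = 0)"

text \<open>Freeness of the quotient is the only property of the algebra, besides the value of \<open>s\<close>, that
the local geometry of the congruence depends on.  It does not follow from \<open>T\<^sup>2 = s\<close>: for \<open>s = 1\<close> the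
two eigenspaces could have different dimensions.\<close>

locale quadratic_operator =
  fixes T :: "real^(3 \<times> 2)^(3 \<times> 2)" and s :: real
  assumes T_T: "T *v (T *v x) = s *\<^sub>R x"
    and free_quotient: "lin_pair x (T *v x) \<Longrightarrow> free_quotient T x"
begin

definition K :: "R6 set set" where
  "K = {span {x, T *v x} | x. lin_pair x (T *v x)}"

lemmas T_simps = matrix_vector_right_distrib matrix_vector_mult_scaleR T_T
  matrix_vector_mult_diff_distrib

lemma T_span_pair: "v \<in> span {x, T *v x} \<Longrightarrow> T *v v \<in> span {x, T *v x}"
proof -
  assume "v \<in> span {x, T *v x}"
  then obtain p q where v: "v = p *\<^sub>R x + q *\<^sub>R (T *v x)" by (rule in_span_pairE)
  have "T *v v = (q * s) *\<^sub>R x + p *\<^sub>R (T *v x)"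
    by (simp add: v T_simps)
  then show ?thesis using in_span_pair by metis
qed

lemma K_subset_lines: "K \<subseteq> lines"
  by (auto simp: K_def lines_def dim_span_pair_iff[symmetric])

lemma T_line: "L \<in> K \<Longrightarrow> v \<in> L \<Longrightarrow> T *v v \<in> L"
  by (auto simp: K_def T_span_pair)

text \<open>A line of \<open>K\<close> is generated by each of its vectors \<open>v\<close> for which \<open>v\<close> and \<open>T v\<close> are independent,
because it is \<open>T\<close>-invariant and of dimension 2.\<close>

lemma line_eq_span:
  assumes "L \<in> K" "v \<in> L" "lin_pair v (T *v v)"
  shows "L = span {v, T *v v}"
  using assms K_subset_lines T_line
  by (intro span_pair_eq_subspace[symmetric]) (auto simp: lines_def)

end

section \<open>The projective plane over an algebra\<close>

text \<open>The first column identifies \<open>A\<^sup>3\<close> with \<open>\<real>\<^sup>6\<close> so that \<open>T\<close> is multiplication by the generator of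
\<open>A\<close>, and \<open>el p q\<close> is the element \<open>p + q T\<close> of \<open>A\<close>.\<close>

locale algebra_representation = quadratic_operator T s
  for T s +
  fixes \<rho> :: "'a::comm_ring_1 \<Rightarrow> real^2^2" and el :: "real \<Rightarrow> real \<Rightarrow> 'a"
  assumes column_2: "column 2 (point_mat \<rho> X) = T *v column 1 (point_mat \<rho> X)"
    and column_1_surj: "\<exists>X. column 1 (point_mat \<rho> X) = x"
    and column_1_inj: "column 1 (point_mat \<rho> X) = column 1 (point_mat \<rho> Y) \<Longrightarrow> X = Y"
    and column_1_mult: "column 1 (point_mat \<rho> (\<chi> k. X $ k * el p q)) =
      p *\<^sub>R column 1 (point_mat \<rho> X) + q *\<^sub>R (T *v column 1 (point_mat \<rho> X))"
    and el_surj: "\<exists>p q. P = el p q"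
    and nonzero_divisor_iff: "nonzero_divisor (el p q) \<longleftrightarrow> p\<^sup>2 - s * q\<^sup>2 \<noteq> 0"
begin

abbreviation col where "col X \<equiv> column 1 (point_mat \<rho> X)"

lemma point_reps_iff: "X \<in> point_reps \<rho> \<longleftrightarrow> lin_pair (col X) (T *v col X)"
  by (simp add: point_reps_def column_2 lin_pair_iff_independent)

lemma column_line_eq: "column_line \<rho> X = span {col X, T *v col X}"
  by (simp add: column_line_def column_2)

lemma line_family_eq: "line_family \<rho> = K"
proof -
  have "line_family \<rho> = {span {col X, T *v col X} | X. lin_pair (col X) (T *v col X)}"
    unfolding line_family_def image_def using point_reps_iff column_line_eq by auto
  also have "\<dots> = K"
    unfolding K_def using column_1_surj by (metis (no_types, lifting))
  finally show ?thesis .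
qed

lemma column_line_in_K: "X \<in> point_reps \<rho> \<Longrightarrow> column_line \<rho> X \<in> K"
  unfolding line_family_eq[symmetric] line_family_def by blast

text \<open>The norm \<open>p\<^sup>2 - s q\<^sup>2\<close> is the determinant of the passage from \<open>x, T x\<close> to \<open>y, T y\<close>.\<close>

lemma lin_pair_multiple_iff:
  assumes x: "lin_pair x (T *v x)" and y: "y = p *\<^sub>R x + q *\<^sub>R (T *v x)"
  shows "lin_pair y (T *v y) \<longleftrightarrow> p\<^sup>2 - s * q\<^sup>2 \<noteq> 0"
proof
  assume n: "p\<^sup>2 - s * q\<^sup>2 \<noteq> 0"
  show "lin_pair y (T *v y)"
    unfolding lin_pair_def
  proof (intro allI impI)
    fix c d assume "c *\<^sub>R y + d *\<^sub>R (T *v y) = 0"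
    then have "(c * p + d * q * s) *\<^sub>R x + (c * q + d * p) *\<^sub>R (T *v x) = 0"
      by (simp add: y T_simps algebra_simps)
    from lin_pairD[OF x this] have e: "c * p + d * q * s = 0" "c * q + d * p = 0" by auto
    have "c * (p\<^sup>2 - s * q\<^sup>2) = p * (c * p + d * q * s) - s * q * (c * q + d * p)"
      "d * (p\<^sup>2 - s * q\<^sup>2) = p * (c * q + d * p) - q * (c * p + d * q * s)"
      by (simp_all add: algebra_simps power2_eq_square)
    then have "c * (p\<^sup>2 - s * q\<^sup>2) = 0" "d * (p\<^sup>2 - s * q\<^sup>2) = 0" unfolding e by simp_all
    with n show "c = 0 \<and> d = 0" by simp
  qed
next
  assume l: "lin_pair y (T *v y)"
  show "p\<^sup>2 - s * q\<^sup>2 \<noteq> 0"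
  proof
    assume n: "p\<^sup>2 - s * q\<^sup>2 = 0"
    have "p *\<^sub>R y + (- q) *\<^sub>R (T *v y) = (p\<^sup>2 - s * q\<^sup>2) *\<^sub>R x"
      by (simp add: y T_simps algebra_simps power2_eq_square)
    then have "p *\<^sub>R y + (- q) *\<^sub>R (T *v y) = 0" unfolding n by simp
    from lin_pairD[OF l this] have "y = 0" by (simp add: y)
    then show False using lin_pairD[OF l, of 1 0] by simp
  qed
qed

text \<open>If \<open>Y\<close> spans the line of \<open>X\<close>, the coefficients of its first column in the basis \<open>x, T x\<close> are the
required factor \<open>p + q T\<close>; the independence of the columns of \<open>Y\<close> makes this factor invertible.\<close>

lemma point_rel_iff:
  "(X, Y) \<in> point_rel \<rho> \<longleftrightarrow>
    X \<in> point_reps \<rho> \<and> Y \<in> point_reps \<rho> \<and> column_line \<rho> X = column_line \<rho> Y"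
proof (cases "X \<in> point_reps \<rho> \<and> Y \<in> point_reps \<rho>")
  case True
  then have X: "lin_pair (col X) (T *v col X)" and Y: "lin_pair (col Y) (T *v col Y)"
    by (auto simp: point_reps_iff)
  have "(\<exists>P. nonzero_divisor P \<and> Y = (\<chi> k. X $ k * P)) \<longleftrightarrow> column_line \<rho> X = column_line \<rho> Y"
  proof
    assume "\<exists>P. nonzero_divisor P \<and> Y = (\<chi> k. X $ k * P)"
    then obtain p q where "Y = (\<chi> k. X $ k * el p q)" using el_surj by metis
    then have "col Y = p *\<^sub>R col X + q *\<^sub>R (T *v col X)" using column_1_mult by simp
    then have "col Y \<in> column_line \<rho> X" using in_span_pair unfolding column_line_eq by metis
    from line_eq_span[OF column_line_in_K this Y] True
    show "column_line \<rho> X = column_line \<rho> Y" unfolding column_line_eq by blast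
  next
    assume "column_line \<rho> X = column_line \<rho> Y"
    then have "col Y \<in> span {col X, T *v col X}"
      unfolding column_line_eq by (simp add: span_base)
    then obtain p q where pq: "col Y = p *\<^sub>R col X + q *\<^sub>R (T *v col X)" by (rule in_span_pairE)
    then have "Y = (\<chi> k. X $ k * el p q)"
      by (intro column_1_inj) (simp add: column_1_mult)
    moreover have "nonzero_divisor (el p q)"
      using lin_pair_multiple_iff[OF X pq] Y by (simp add: nonzero_divisor_iff)
    ultimately show "\<exists>P. nonzero_divisor P \<and> Y = (\<chi> k. X $ k * P)" by blast
  qed
  then show ?thesis using True by (simp add: point_rel_def)
qed (auto simp: point_rel_def)

lemma column_line_respects: "column_line \<rho> respects point_rel \<rho>"
  by (auto simp: congruent_def point_rel_iff)

text \<open>By \<open>point_rel_iff\<close>, \<open>point_rel\<close> is the kernel relation of \<open>column_line\<close> on the representatives,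
so the induced map on classes is a bijection onto the image.\<close>

lemma point_line_bij: "bij_betw (point_line \<rho>) (proj_plane \<rho>) (line_family \<rho>)"
proof -
  define C where "C X = point_rel \<rho> `` {X}" for X
  have plane: "proj_plane \<rho> = C ` point_reps \<rho>"
    by (auto simp: proj_plane_def quotient_def C_def)
  have line: "point_line \<rho> (C X) = column_line \<rho> X" if "X \<in> point_reps \<rho>" for X
  proof -
    have "column_line \<rho> ` C X = {column_line \<rho> X}"
      using that by (auto simp: C_def point_rel_iff)
    then show ?thesis by (simp add: point_line_def)
  qed
  have "inj_on (point_line \<rho>) (proj_plane \<rho>)"
  proof (rule inj_onI)
    fix x y assume "x \<in> proj_plane \<rho>" "y \<in> proj_plane \<rho>" "point_line \<rho> x = point_line \<rho> y"
    then obtain X Y where "x = C X" "y = C Y" "X \<in> point_reps \<rho>" "Y \<in> point_reps \<rho>"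
      "column_line \<rho> X = column_line \<rho> Y" using line unfolding plane by auto
    then show "x = y" by (auto simp: C_def point_rel_iff)
  qed
  moreover have "point_line \<rho> ` proj_plane \<rho> = line_family \<rho>"
    unfolding plane line_family_def using line by (auto simp: image_iff) 
  ultimately show ?thesis by (simp add: bij_betw_def)
qed

end

section \<open>Frames adapted to a line\<close>

text \<open>The dual basis of \<open>x, y\<close> inside their own span.  Its multiples \<open>u\<close>, \<open>v\<close> by the Gram determinant \<open>D\<close>
are read off from Cramer's rule, and \<open>D = 0\<close> would make \<open>u\<close> orthogonal to itself.\<close>

lemma dual_pair_exists:
  fixes x :: "'a::euclidean_space"
  assumes l: "lin_pair x y"
  obtains a b where "a \<in> span {x, y}" "b \<in> span {x, y}"
    "a \<bullet> x = 1" "a \<bullet> y = 0" "b \<bullet> x = 0" "b \<bullet> y = 1"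
proof -
  define D where "D = (x \<bullet> x) * (y \<bullet> y) - (x \<bullet> y) * (x \<bullet> y)"
  define u where "u = (y \<bullet> y) *\<^sub>R x + (- (x \<bullet> y)) *\<^sub>R y"
  define v where "v = (- (x \<bullet> y)) *\<^sub>R x + (x \<bullet> x) *\<^sub>R y"
  have uv: "u \<bullet> x = D" "u \<bullet> y = 0" "v \<bullet> x = 0" "v \<bullet> y = D"
    by (simp_all add: u_def v_def D_def algebra_simps inner_commute)
  have "D \<noteq> 0"
  proof
    assume "D = 0"
    have "u \<bullet> u = u \<bullet> ((y \<bullet> y) *\<^sub>R x + (- (x \<bullet> y)) *\<^sub>R y)"
      by (simp only: u_def)
    also have "\<dots> = 0"
      unfolding inner_right_distrib inner_scaleR_right uv by (simp add: \<open>D = 0\<close>)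
    finally have "u \<bullet> u = 0" .
    then have "u = 0" by simp
    then have "y \<bullet> y = 0" using lin_pairD[OF l] unfolding u_def by blast
    then show False using lin_pairD[OF l, of 0 1] by simp
  qed
  moreover have "u \<in> span {x, y}" "v \<in> span {x, y}"
    unfolding u_def v_def by (rule in_span_pair)+
  ultimately show ?thesis
    using uv by (intro that[of "u /\<^sub>R D" "v /\<^sub>R D"]) (auto intro: span_scale)
qed

definition minor :: "'a::real_inner \<Rightarrow> 'a \<Rightarrow> 'a \<Rightarrow> 'a \<Rightarrow> real" where
  "minor \<alpha> \<beta> x y = (\<alpha> \<bullet> x) * (\<beta> \<bullet> y) - (\<alpha> \<bullet> y) * (\<beta> \<bullet> x)"

text \<open>Choosing \<open>\<alpha>\<close> and \<open>\<beta>\<close> in \<open>L\<close> makes them at once the coordinate functionals of \<open>L\<close> and equations of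
\<open>L\<^sup>\<bottom>\<close>, which represents the quotient \<open>\<real>\<^sup>6 / L\<close>.\<close>

locale line_frame = quadratic_operator +
  fixes x\<^sub>0 \<alpha> \<beta> :: R6
  assumes generator: "lin_pair x\<^sub>0 (T *v x\<^sub>0)"
    and \<alpha>_in_L: "\<alpha> \<in> span {x\<^sub>0, T *v x\<^sub>0}" and \<beta>_in_L: "\<beta> \<in> span {x\<^sub>0, T *v x\<^sub>0}"
    and dual [simp]: "\<alpha> \<bullet> x\<^sub>0 = 1" "\<alpha> \<bullet> (T *v x\<^sub>0) = 0" "\<beta> \<bullet> x\<^sub>0 = 0" "\<beta> \<bullet> (T *v x\<^sub>0) = 1"

context quadratic_operator
begin

lemma line_frame_at:
  assumes x: "lin_pair x (T *v x)"
  obtains \<alpha> \<beta> where "line_frame T s x \<alpha> \<beta>"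
proof -
  obtain \<alpha> \<beta> where "\<alpha> \<in> span {x, T *v x}" "\<beta> \<in> span {x, T *v x}"
    "\<alpha> \<bullet> x = 1" "\<alpha> \<bullet> (T *v x) = 0" "\<beta> \<bullet> x = 0" "\<beta> \<bullet> (T *v x) = 1"
    by (rule dual_pair_exists[OF x])
  with x show ?thesis
    by (intro that[of \<alpha> \<beta>] line_frame.intro quadratic_operator_axioms line_frame_axioms.intro)
qed

lemma line_frame_exists:
  assumes "L \<in> K"
  obtains x \<alpha> \<beta> where "line_frame T s x \<alpha> \<beta>" "L = span {x, T *v x}"
  using assms line_frame_at unfolding K_def by blast

end

context line_frame
begin

abbreviation y\<^sub>0 where "y\<^sub>0 \<equiv> T *v x\<^sub>0"
abbreviation L where "L \<equiv> span {x\<^sub>0, y\<^sub>0}"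
abbreviation W where "W \<equiv> L\<^sup>\<bottom>"

lemma L_in_K: "L \<in> K"
  using generator by (auto simp: K_def)

lemma W_iff: "w \<in> W \<longleftrightarrow> \<alpha> \<bullet> w = 0 \<and> \<beta> \<bullet> w = 0"
proof
  assume "w \<in> W"
  then show "\<alpha> \<bullet> w = 0 \<and> \<beta> \<bullet> w = 0"
    using \<alpha>_in_L \<beta>_in_L by (auto simp: orthogonal_comp_def orthogonal_def)
next
  assume w: "\<alpha> \<bullet> w = 0 \<and> \<beta> \<bullet> w = 0"
  have "lin_pair \<alpha> \<beta>"
    unfolding lin_pair_def
  proof (intro allI impI)
    fix p q assume "p *\<^sub>R \<alpha> + q *\<^sub>R \<beta> = 0"
    then have "(p *\<^sub>R \<alpha> + q *\<^sub>R \<beta>) \<bullet> x\<^sub>0 = 0" "(p *\<^sub>R \<alpha> + q *\<^sub>R \<beta>) \<bullet> y\<^sub>0 = 0" by simp_all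
    then show "p = 0 \<and> q = 0" by (simp add: inner_left_distrib)
  qed
  then have "span {\<alpha>, \<beta>} = L"
    using L_in_K K_subset_lines \<alpha>_in_L \<beta>_in_L
    by (intro span_pair_eq_subspace) (auto simp: lines_def)
  then show "w \<in> W"
    using w by (auto simp: orthogonal_comp_def orthogonal_def span_pair[of \<alpha>] inner_left_distrib
        simp flip: \<open>span {\<alpha>, \<beta>} = L\<close>)
qed

lemma subspace_W: "subspace W"
  by (rule subspace_orthogonal_comp)

lemma dim_W: "dim W = 4"
proof -
  have "dim {y \<in> UNIV. \<forall>x \<in> L. orthogonal x y} + dim L = dim (UNIV :: R6 set)"
    by (rule dim_subspace_orthogonal_to_vectors) auto
  moreover have "dim L = 2"
    using generator dim_span_pair_iff by blast
  ultimately show ?thesis by (simp add: orthogonal_comp_def)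
qed

lemma L_Int_W: "v \<in> L \<Longrightarrow> v \<in> W \<Longrightarrow> v = 0"
  by (erule in_span_pairE) (simp add: W_iff inner_right_distrib)

abbreviation area :: "R6 \<Rightarrow> R6 \<Rightarrow> real" where
  "area \<equiv> minor \<alpha> \<beta>"

lemma area_cramer:
  assumes "area x y \<noteq> 0" "p *\<^sub>R x + q *\<^sub>R y \<in> W"
  shows "p = 0 \<and> q = 0"
proof -
  from assms(2) have "p * (\<alpha> \<bullet> x) + q * (\<alpha> \<bullet> y) = 0" "p * (\<beta> \<bullet> x) + q * (\<beta> \<bullet> y) = 0"
    by (simp_all add: W_iff inner_right_distrib)
  moreover have
    "p * area x y = (p * (\<alpha> \<bullet> x) + q * (\<alpha> \<bullet> y)) * (\<beta> \<bullet> y) - (p * (\<beta> \<bullet> x) + q * (\<beta> \<bullet> y)) * (\<alpha> \<bullet> y)"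
    "q * area x y = (p * (\<beta> \<bullet> x) + q * (\<beta> \<bullet> y)) * (\<alpha> \<bullet> x) - (p * (\<alpha> \<bullet> x) + q * (\<alpha> \<bullet> y)) * (\<beta> \<bullet> x)"
    by (simp_all add: minor_def algebra_simps)
  ultimately have "p * area x y = 0" "q * area x y = 0" by simp_all
  with assms(1) show ?thesis by simp
qed

text \<open>For independent \<open>x\<close>, \<open>y\<close> this minor is the Pluecker coordinate of the line \<open>x \<and> y\<close> that detects
whether the line meets \<open>W\<close>.\<close>

lemma area_nonzero_iff:
  "area x y \<noteq> 0 \<longleftrightarrow> lin_pair x y \<and> span {x, y} \<inter> W = {0}"
proof
  assume a: "area x y \<noteq> 0"
  have "lin_pair x y"
    unfolding lin_pair_def using area_cramer[OF a] subspace_0[OF subspace_W] by metis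
  moreover have "v = 0" if "v \<in> span {x, y}" "v \<in> W" for v
    using that area_cramer[OF a] by (metis in_span_pairE add.right_neutral scale_zero_left)
  ultimately show "lin_pair x y \<and> span {x, y} \<inter> W = {0}"
    using subspace_0[OF subspace_W] span_zero by blast
next
  assume l: "lin_pair x y \<and> span {x, y} \<inter> W = {0}"
  then have c: "p = 0 \<and> q = 0" if "p *\<^sub>R x + q *\<^sub>R y \<in> W" for p q
    using that in_span_pair[of p x q y] lin_pairD[of x y p q] by blast
  show "area x y \<noteq> 0"
  proof
    assume a: "area x y = 0"
    then have "(\<beta> \<bullet> y) *\<^sub>R x + (- (\<beta> \<bullet> x)) *\<^sub>R y \<in> W"
      by (simp add: W_iff inner_diff_right minor_def algebra_simps)
    from c[OF this] have b: "\<beta> \<bullet> x = 0" "\<beta> \<bullet> y = 0" by auto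
    then have "(\<alpha> \<bullet> y) *\<^sub>R x + (- (\<alpha> \<bullet> x)) *\<^sub>R y \<in> W"
      by (simp add: W_iff inner_diff_right)
    from c[OF this] have "\<alpha> \<bullet> x = 0" by auto
    with b have "1 *\<^sub>R x + 0 *\<^sub>R y \<in> W" by (simp add: W_iff)
    from c[OF this] show False by simp
  qed
qed

end

section \<open>Charts of the congruence\<close>

lemma smooth_on_const: "smooth_on U (\<lambda>x. c)"
proof -
  have "smooth_on U f" if "\<exists>c. f = (\<lambda>x. c)" for f :: "'a \<Rightarrow> 'b"
    using that
  proof (coinduction arbitrary: f)
    case smooth_on
    then obtain c where "f = (\<lambda>x. c)" ..
    then show ?case
      by (intro exI[of _ "\<lambda>x h. 0"] exI[of _ f]) auto
  qed
  then show ?thesis by blast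
qed

text \<open>The derivative of an affine map is a constant function of the point, so only the coinductive
smoothness of constants is needed.\<close>

lemma smooth_on_affine:
  assumes "linear g"
  shows "smooth_on U (\<lambda>x. c + g x)"
proof (rule smooth_on.intros[where f' = "\<lambda>x. g"])
  show "((\<lambda>x. c + g x) has_derivative g) (at x)" for x
    using linear_imp_has_derivative[OF assms] by (auto intro!: derivative_eq_intros)
qed (rule smooth_on_const)

context line_frame
begin

text \<open>The lines that are complementary to \<open>W\<close> and whose unique vector in \<open>x\<^sub>0 + W\<close> has coordinates in \<open>V\<close>
form an open set, since Cramer's rule (\<open>\<sigma>\<close> below) gives this vector as a continuous function of any
pair spanning the line.  The map \<open>J'\<close> plays the role of a coordinate system on \<open>W\<close>.\<close>

lemma grassmannian_chart_domain_open:
  fixes J' :: "R6 \<Rightarrow> real^4"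
  assumes J': "linear J'" and V: "open V"
  shows "openin grassmannian
    {M \<in> lines. M \<inter> W = {0} \<and> (\<exists>v\<in>M. v - x\<^sub>0 \<in> W \<and> J' (v - x\<^sub>0) \<in> V)}"
    (is "openin _ ?N")
proof -
  define \<sigma> where "\<sigma> x y = inverse (area x y) *\<^sub>R ((\<beta> \<bullet> y) *\<^sub>R x + (- (\<beta> \<bullet> x)) *\<^sub>R y)" for x y
  have \<sigma>_span: "\<sigma> x y \<in> span {x, y}" for x y
    unfolding \<sigma>_def by (intro span_scale in_span_pair)
  have \<sigma>_W: "\<sigma> x y - x\<^sub>0 \<in> W" if "area x y \<noteq> 0" for x y
  proof -
    have "\<alpha> \<bullet> ((\<beta> \<bullet> y) *\<^sub>R x + (- (\<beta> \<bullet> x)) *\<^sub>R y) = area x y"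
      by (simp add: minor_def inner_diff_right algebra_simps)
    moreover have "\<beta> \<bullet> ((\<beta> \<bullet> y) *\<^sub>R x + (- (\<beta> \<bullet> x)) *\<^sub>R y) = 0"
      by (simp add: inner_diff_right algebra_simps)
    ultimately show ?thesis
      using that unfolding \<sigma>_def by (simp only: W_iff inner_diff_right inner_scaleR_right dual) simp
  qed
  \<comment> \<open>The vector \<open>v\<close> in the definition of the set must be \<open>\<sigma> x y\<close>: their difference lies in the line and in \<open>W\<close>.\<close>
  have N: "span {x, y} \<in> ?N \<longleftrightarrow> area x y \<noteq> 0 \<and> J' (\<sigma> x y - x\<^sub>0) \<in> V" for x y
  proof -
    have "span {x, y} \<in> lines \<longleftrightarrow> lin_pair x y"
      using dim_span_pair_iff by (auto simp: lines_def)
    moreover have "(\<exists>v\<in>span {x, y}. v - x\<^sub>0 \<in> W \<and> J' (v - x\<^sub>0) \<in> V) \<longleftrightarrow> J' (\<sigma> x y - x\<^sub>0) \<in> V"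
      if a: "area x y \<noteq> 0"
    proof -
      have "v = \<sigma> x y" if v: "v \<in> span {x, y}" "v - x\<^sub>0 \<in> W" for v
      proof -
        have "v - \<sigma> x y \<in> W"
          using subspace_diff[OF subspace_W v(2) \<sigma>_W[OF a]] by simp
        moreover have "v - \<sigma> x y \<in> span {x, y}"
          using v(1) \<sigma>_span span_diff by blast
        ultimately have "v - \<sigma> x y = 0" using a area_nonzero_iff by blast
        then show ?thesis by simp
      qed
      then show ?thesis using \<sigma>_span \<sigma>_W[OF a] by metis
    qed
    ultimately show ?thesis using area_nonzero_iff[of x y] by auto
  qed
  define \<O> where "\<O> = {z. area (fst z) (snd z) \<noteq> 0}"
  have "open \<O>"
    unfolding \<O>_def minor_def by (intro open_Collect_neq continuous_intros)
  moreover have "continuous_on \<O> (\<lambda>z. J' (\<sigma> (fst z) (snd z) - x\<^sub>0))"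
    unfolding \<sigma>_def \<O>_def minor_def
    by (intro continuous_on_compose2[OF linear_continuous_on[OF linear_conv_bounded_linear[THEN iffD1, OF J'], of UNIV]]
        continuous_intros) auto
  ultimately have "open (\<O> \<inter> (\<lambda>z. J' (\<sigma> (fst z) (snd z) - x\<^sub>0)) -` V)"
    using continuous_open_preimage V by blast
  moreover have "{(x, y). span {x, y} \<in> ?N} = \<O> \<inter> (\<lambda>z. J' (\<sigma> (fst z) (snd z) - x\<^sub>0)) -` V"
    using N by (auto simp: \<O>_def)
  ultimately show ?thesis
    by (simp only: openin_grassmannian) auto
qed

text \<open>The chart sends \<open>u\<close> to the line generated by \<open>x\<^sub>0 + J u\<close>, where \<open>J\<close> identifies \<open>\<real>\<^sup>4\<close> with \<open>W\<close>, on the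
open set of those \<open>u\<close> for which this line is complementary to \<open>W\<close>.  The inverse takes a line to
its unique vector in \<open>x\<^sub>0 + W\<close>; in particular the image of an open set is cut out of \<open>K\<close> by one of
the open sets of the preceding lemma.  The chart is an immersion because \<open>J h\<close> lies in \<open>W\<close>,
which meets the line only in 0.\<close>

lemma chart_at_L:
  "\<exists>(U :: (real^4) set) a b.
    open U \<and> smooth_on U a \<and> smooth_on U b \<and>
    L \<in> (\<lambda>u. span {a u, b u}) ` U \<and>
    openin (subtopology grassmannian K) ((\<lambda>u. span {a u, b u}) ` U) \<and>
    embedding_map (top_of_set U) grassmannian (\<lambda>u. span {a u, b u}) \<and>
    (\<forall>u\<in>U. \<forall>h. h \<noteq> 0 \<longrightarrow>
       \<not> (frechet_derivative a (at u) h \<in> span {a u, b u} \<and>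
          frechet_derivative b (at u) h \<in> span {a u, b u}))"
proof -
  have "dim (UNIV :: (real^4) set) = dim W" by (simp add: dim_W)
  then obtain J :: "real^4 \<Rightarrow> R6" and J' where J: "linear J" "linear J'" "range J = W"
    "\<And>u. J' (J u) = u" "\<And>w. w \<in> W \<Longrightarrow> J (J' w) = w"
    using isometries_subspaces[OF subspace_UNIV subspace_W, where ?'a = "real^4"]
    by (metis UNIV_I)
  have J_W: "J u \<in> W" for u using J(3) by blast
  define a where "a u = x\<^sub>0 + J u" for u
  define b where "b u = T *v a u" for u
  define f where "f u = span {a u, b u}" for u
  define U where "U = {u. \<beta> \<bullet> b u \<noteq> 0}"
  have a_coords: "\<alpha> \<bullet> a u = 1" "\<beta> \<bullet> a u = 0" for u
    using J_W[of u] by (auto simp: a_def W_iff inner_right_distrib)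
  have b_eq: "b u = y\<^sub>0 + T *v J u" for u
    by (simp add: b_def a_def T_simps)
  have linear_TJ: "linear (\<lambda>u. T *v J u)"
    using linear_compose[OF J(1) matrix_vector_mul_linear[of T]] by (simp add: o_def)
  have cont: "continuous_on S a" "continuous_on S b" for S
    unfolding a_def b_eq using J(1) linear_TJ
    by (intro continuous_intros linear_continuous_on; simp add: linear_conv_bounded_linear)+
  have "open U"
    unfolding U_def by (intro open_Collect_neq continuous_intros cont)
  have smooth: "smooth_on U a" "smooth_on U b"
    unfolding a_def b_eq using J(1) linear_TJ smooth_on_affine by blast+
  have area_U: "area (a u) (b u) \<noteq> 0" if "u \<in> U" for u
    using that by (simp add: U_def minor_def a_coords)
  have lin_U: "lin_pair (a u) (T *v a u)" if "u \<in> U" for u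
    using area_U[OF that] area_nonzero_iff b_def by metis
  have f_K: "f u \<in> K" if "u \<in> U" for u
    using lin_U[OF that] by (auto simp: K_def f_def b_def)
  \<comment> \<open>The vectors of the line with vanishing \<open>\<beta>\<close>-coordinate are the multiples of \<open>a u\<close>.\<close>
  have mem_f: "v = (\<alpha> \<bullet> v) *\<^sub>R a u" if u: "u \<in> U" and f: "v \<in> f u" and \<beta>: "\<beta> \<bullet> v = 0" for u v
  proof -
    obtain p q where v: "v = p *\<^sub>R a u + q *\<^sub>R b u"
      using f unfolding f_def by (rule in_span_pairE)
    with u \<beta> have "q = 0" by (simp add: inner_right_distrib a_coords U_def)
    then show ?thesis by (simp add: v a_coords)
  qed
  have inj: "inj_on f U"
  proof (rule inj_onI)
    fix u u' assume "u \<in> U" "u' \<in> U" "f u = f u'"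
    then have "a u' \<in> f u" by (simp add: f_def span_base)
    from mem_f[OF \<open>u \<in> U\<close> this] have "a u' = a u" by (simp add: a_coords)
    then show "u = u'" unfolding a_def using J(4) by (metis add_left_cancel)
  qed
  \<comment> \<open>A line of \<open>K\<close> whose vector in \<open>x\<^sub>0 + W\<close> is some \<open>a u\<close> with \<open>u \<in> U\<close> is generated by it.\<close>
  have image: "\<exists>N. openin grassmannian N \<and> f ` V = N \<inter> K" if V: "open V" "V \<subseteq> U" for V
  proof (intro exI conjI)
    let ?N = "{M \<in> lines. M \<inter> W = {0} \<and> (\<exists>v\<in>M. v - x\<^sub>0 \<in> W \<and> J' (v - x\<^sub>0) \<in> V)}"
    show "openin grassmannian ?N"
      by (rule grassmannian_chart_domain_open[OF J(2) V(1)])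
    show "f ` V = ?N \<inter> K"
    proof (intro subset_antisym subsetI)
      fix M assume "M \<in> f ` V"
      then obtain u where u: "u \<in> V" "u \<in> U" "M = f u" using V(2) by blast
      have "M \<inter> W = {0}" using area_U[OF u(2)] area_nonzero_iff u(3) f_def by simp
      moreover have "a u \<in> M" by (simp add: u(3) f_def span_base)
      moreover have "a u - x\<^sub>0 \<in> W" "J' (a u - x\<^sub>0) \<in> V"
        using u(1) J(4) J_W by (simp_all add: a_def)
      moreover have "M \<in> K" "M \<in> lines"
        using f_K[OF u(2)] K_subset_lines u(3) by auto
      ultimately show "M \<in> ?N \<inter> K"
        by (intro IntI CollectI conjI bexI[of _ "a u"])
    next
      fix M assume M: "M \<in> ?N \<inter> K"
      then obtain v where v: "v \<in> M" "v - x\<^sub>0 \<in> W" "J' (v - x\<^sub>0) \<in> V" by blast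
      let ?u = "J' (v - x\<^sub>0)"
      have "a ?u = v" using J(5)[OF v(2)] by (simp add: a_def)
      moreover have "?u \<in> U" using v(3) V(2) by blast
      ultimately have "lin_pair v (T *v v)" "f ?u = span {v, T *v v}"
        using lin_U[of ?u] by (simp_all only: f_def b_def)
      then have "M = f ?u"
        using line_eq_span[of M v] M v(1) by blast
      then show "M \<in> f ` V" using v(3) by (rule image_eqI)
    qed
  qed
  have "0 \<in> U"
    using linear_0[OF J(1)] by (simp add: U_def b_def a_def)
  moreover have "f 0 = L"
    using linear_0[OF J(1)] by (simp add: f_def b_def a_def)
  ultimately have L_f: "L \<in> f ` U" by blast
  obtain N\<^sub>U where N\<^sub>U: "openin grassmannian N\<^sub>U" "f ` U = N\<^sub>U \<inter> K"
    using image[OF \<open>open U\<close>] by blast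
  have f_top: "f ` U \<subseteq> topspace grassmannian"
    using openin_subset[OF N\<^sub>U(1)] N\<^sub>U(2) by blast
  have "continuous_map (top_of_set U) grassmannian f"
    unfolding continuous_map_def
  proof (intro conjI allI impI)
    show "f \<in> topspace (top_of_set U) \<rightarrow> topspace grassmannian"
      using f_top by auto
    fix N assume "openin grassmannian N"
    then have "open {(x, y). span {x, y} \<in> N}" by (simp add: openin_grassmannian)
    moreover have "continuous_on U (\<lambda>u. (a u, b u))"
      by (intro continuous_intros cont)
    ultimately have "openin (top_of_set U) (U \<inter> (\<lambda>u. (a u, b u)) -` {(x, y). span {x, y} \<in> N})"
      by (rule continuous_openin_preimage_gen[rotated])
    also have "U \<inter> (\<lambda>u. (a u, b u)) -` {(x, y). span {x, y} \<in> N} =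
        {u \<in> topspace (top_of_set U). f u \<in> N}"
      by (auto simp: f_def)
    finally show "openin (top_of_set U) {u \<in> topspace (top_of_set U). f u \<in> N}" .
  qed
  moreover have "open_map (top_of_set U) (subtopology grassmannian (f ` U)) f"
    unfolding open_map_def
  proof (intro allI impI)
    fix V assume "openin (top_of_set U) V"
    then have "open V" "V \<subseteq> U" using openin_open_eq[OF \<open>open U\<close>] by blast+
    from image[OF this] obtain N where "openin grassmannian N" "f ` V = N \<inter> K" by blast
    moreover from this have "f ` V = N \<inter> f ` U" using \<open>V \<subseteq> U\<close> f_K by blast
    ultimately show "openin (subtopology grassmannian (f ` U)) (f ` V)"
      by (auto simp: openin_subtopology)
  qed
  moreover have "topspace (subtopology grassmannian (f ` U)) = f ` U"
    using f_top by auto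
  ultimately have "embedding_map (top_of_set U) grassmannian f"
    unfolding embedding_map_def
    by (intro bijective_open_imp_homeomorphic_map)
      (auto simp: inj continuous_map_in_subtopology)
  moreover have "openin (subtopology grassmannian K) (f ` U)"
    using N\<^sub>U by (auto simp: openin_subtopology)
  moreover have "frechet_derivative a (at u) h \<notin> f u" if "u \<in> U" "h \<noteq> 0" for u h
  proof
    assume m: "frechet_derivative a (at u) h \<in> f u"
    have "(a has_derivative J) (at u)"
      unfolding a_def using linear_imp_has_derivative[OF J(1)]
      by (auto intro!: derivative_eq_intros)
    then have "frechet_derivative a (at u) = J" by (rule frechet_derivative_at[symmetric])
    with m have "J h \<in> f u" by simp
    moreover have "\<alpha> \<bullet> J h = 0" "\<beta> \<bullet> J h = 0" using J_W[of h] by (auto simp: W_iff)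
    ultimately have "J h = 0" using mem_f[OF that(1)] by fastforce
    then show False using J(4)[of h] linear_0[OF J(2)] that(2) by simp
  qed
  moreover have f_eq: "f = (\<lambda>u. span {a u, b u})"
    by (simp add: f_def fun_eq_iff)
  ultimately show ?thesis
    using \<open>open U\<close> smooth L_f unfolding f_eq
    by (intro exI[of _ U] exI[of _ a] exI[of _ b]) simp
qed

end

lemma (in quadratic_operator) congruence_K: "congruence K"
  unfolding congruence_def
proof (intro conjI ballI)
  fix L assume "L \<in> K"
  then obtain x\<^sub>0 \<alpha> \<beta> where "line_frame T s x\<^sub>0 \<alpha> \<beta>" and L: "L = span {x\<^sub>0, T *v x\<^sub>0}"
    by (rule line_frame_exists)
  then interpret line_frame T s x\<^sub>0 \<alpha> \<beta> by simp
  show "\<exists>(U :: (real^4) set) a b.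
    open U \<and> smooth_on U a \<and> smooth_on U b \<and>
    L \<in> (\<lambda>u. span {a u, b u}) ` U \<and>
    openin (subtopology grassmannian K) ((\<lambda>u. span {a u, b u}) ` U) \<and>
    embedding_map (top_of_set U) grassmannian (\<lambda>u. span {a u, b u}) \<and>
    (\<forall>u\<in>U. \<forall>h. h \<noteq> 0 \<longrightarrow>
       \<not> (frechet_derivative a (at u) h \<in> span {a u, b u} \<and>
          frechet_derivative b (at u) h \<in> span {a u, b u}))"
    unfolding L by (rule chart_at_L)
qed (rule K_subset_lines)

section \<open>Tangent spaces\<close>

lemma cramer_plane:
  assumes "u \<in> span {x, y}"
  shows "minor \<alpha> \<beta> x y *\<^sub>R u = minor \<alpha> \<beta> u y *\<^sub>R x + minor \<alpha> \<beta> x u *\<^sub>R y"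
proof -
  obtain p q where u: "u = p *\<^sub>R x + q *\<^sub>R y" using assms by (rule in_span_pairE)
  have "minor \<alpha> \<beta> u y = p * minor \<alpha> \<beta> x y" "minor \<alpha> \<beta> x u = q * minor \<alpha> \<beta> x y"
    by (simp_all add: u minor_def inner_right_distrib algebra_simps)
  then show ?thesis by (simp add: u algebra_simps)
qed

lemma has_derivative_minor:
  assumes "(x has_vector_derivative x') (at t)" "(y has_vector_derivative y') (at t)"
  shows "((\<lambda>t. minor \<alpha> \<beta> (x t) (y t)) has_real_derivative
    minor \<alpha> \<beta> x' (y t) + minor \<alpha> \<beta> (x t) y') (at t)"
proof -
  have d: "((\<lambda>t. c \<bullet> x t) has_real_derivative c \<bullet> x') (at t)"
    "((\<lambda>t. c \<bullet> y t) has_real_derivative c \<bullet> y') (at t)" for c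
    using assms unfolding has_real_derivative_iff_has_vector_derivative
    by (auto intro: bounded_linear.has_vector_derivative[OF bounded_linear_inner_right])
  show ?thesis
    unfolding minor_def by (rule derivative_eq_intros d refl)+ (simp add: algebra_simps)
qed

text \<open>If \<open>z\<close> moves in the plane spanned by \<open>a\<close> and \<open>b\<close>, then modulo this plane \<open>z'\<close> is the same combination
of \<open>a'\<close> and \<open>b'\<close> as \<open>z\<close> is of \<open>a\<close> and \<open>b\<close>.  Differentiating Cramer's rule without its denominator
proves this without asking whether the coefficients are differentiable.\<close>

lemma derivative_in_moving_plane:
  fixes z a b :: "real \<Rightarrow> 'a::real_inner"
  assumes z: "(z has_vector_derivative z') (at t)" and a: "(a has_vector_derivative a') (at t)"
    and b: "(b has_vector_derivative b') (at t)"
    and S: "open S" "t \<in> S" "\<And>t. t \<in> S \<Longrightarrow> z t \<in> span {a t, b t}"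
  shows "minor \<alpha> \<beta> (a t) (b t) *\<^sub>R z'
    - (minor \<alpha> \<beta> (z t) (b t) *\<^sub>R a' + minor \<alpha> \<beta> (a t) (z t) *\<^sub>R b') \<in> span {a t, b t}"
proof -
  have rearrange: "u - (p + q) = c + d - v" if "u + v = (p + c) + (q + d)"
    for u v p q c d :: 'a
  proof -
    have "u = (p + c) + (q + d) - v" using that by (simp add: eq_diff_eq)
    then show ?thesis by simp
  qed
  have "((\<lambda>t. minor \<alpha> \<beta> (z t) (b t) *\<^sub>R a t + minor \<alpha> \<beta> (a t) (z t) *\<^sub>R b t)
      has_vector_derivative
      (minor \<alpha> \<beta> (z t) (b t) *\<^sub>R a' + (minor \<alpha> \<beta> z' (b t) + minor \<alpha> \<beta> (z t) b') *\<^sub>R a t)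
    + (minor \<alpha> \<beta> (a t) (z t) *\<^sub>R b' + (minor \<alpha> \<beta> a' (z t) + minor \<alpha> \<beta> (a t) z') *\<^sub>R b t)) (at t)"
    by (intro has_vector_derivative_add has_vector_derivative_scaleR has_derivative_minor z a b)
  then have "((\<lambda>t. minor \<alpha> \<beta> (a t) (b t) *\<^sub>R z t)
      has_vector_derivative
      (minor \<alpha> \<beta> (z t) (b t) *\<^sub>R a' + (minor \<alpha> \<beta> z' (b t) + minor \<alpha> \<beta> (z t) b') *\<^sub>R a t)
    + (minor \<alpha> \<beta> (a t) (z t) *\<^sub>R b' + (minor \<alpha> \<beta> a' (z t) + minor \<alpha> \<beta> (a t) z') *\<^sub>R b t)) (at t)"
    using S(1,2) by (rule has_vector_derivative_transform_within_open) (rule cramer_plane[OF S(3), symmetric])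
  moreover have "((\<lambda>t. minor \<alpha> \<beta> (a t) (b t) *\<^sub>R z t) has_vector_derivative
      minor \<alpha> \<beta> (a t) (b t) *\<^sub>R z' + (minor \<alpha> \<beta> a' (b t) + minor \<alpha> \<beta> (a t) b') *\<^sub>R z t) (at t)"
    by (intro has_vector_derivative_scaleR has_derivative_minor z a b)
  ultimately have "minor \<alpha> \<beta> (a t) (b t) *\<^sub>R z' + (minor \<alpha> \<beta> a' (b t) + minor \<alpha> \<beta> (a t) b') *\<^sub>R z t =
      (minor \<alpha> \<beta> (z t) (b t) *\<^sub>R a' + (minor \<alpha> \<beta> z' (b t) + minor \<alpha> \<beta> (z t) b') *\<^sub>R a t)
    + (minor \<alpha> \<beta> (a t) (z t) *\<^sub>R b' + (minor \<alpha> \<beta> a' (z t) + minor \<alpha> \<beta> (a t) z') *\<^sub>R b t)"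
    by (rule vector_derivative_unique_at[rotated])
  then have "minor \<alpha> \<beta> (a t) (b t) *\<^sub>R z'
    - (minor \<alpha> \<beta> (z t) (b t) *\<^sub>R a' + minor \<alpha> \<beta> (a t) (z t) *\<^sub>R b') =
      (minor \<alpha> \<beta> z' (b t) + minor \<alpha> \<beta> (z t) b') *\<^sub>R a t
    + (minor \<alpha> \<beta> a' (z t) + minor \<alpha> \<beta> (a t) z') *\<^sub>R b t
    - (minor \<alpha> \<beta> a' (b t) + minor \<alpha> \<beta> (a t) b') *\<^sub>R z t"
    by (rule rearrange)
  also have "\<dots> \<in> span {a t, b t}"
    using S(3)[OF S(2)] by (intro span_diff in_span_pair span_scale)
  finally show ?thesis .
qed

context line_frame
begin

text \<open>The projection onto \<open>W\<close> along \<open>L\<close>, that is, the quotient map \<open>\<real>\<^sup>6 \<rightarrow> \<real>\<^sup>6 / L\<close>.\<close>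

definition proj :: "R6 \<Rightarrow> R6" where
  "proj v = v - ((\<alpha> \<bullet> v) *\<^sub>R x\<^sub>0 + (\<beta> \<bullet> v) *\<^sub>R y\<^sub>0)"

lemma proj_in_W: "proj v \<in> W"
  by (simp add: W_iff proj_def inner_diff_right inner_right_distrib)

lemma proj_cong_L: "v - proj v \<in> L"
  by (simp add: proj_def in_span_pair)

lemma proj_unique: "w \<in> W \<Longrightarrow> v - w \<in> L \<Longrightarrow> proj v = w"
proof -
  assume "w \<in> W" "v - w \<in> L"
  then have "v - w - (v - proj v) \<in> L" "proj v - w \<in> W"
    using span_diff[OF _ proj_cong_L] subspace_diff[OF subspace_W proj_in_W] by blast+
  then show "proj v = w" using L_Int_W[of "proj v - w"] by simp
qed

lemma linear_proj: "linear proj"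
  by (rule linearI) (simp_all add: proj_def inner_right_distrib algebra_simps)

text \<open>The operator that \<open>T\<close> induces on \<open>\<real>\<^sup>6 / L\<close>.  It need not be the restriction of \<open>T\<close>: for the dual
numbers \<open>W\<close> is in general not \<open>T\<close>-invariant.\<close>

definition \<tau> :: "real^(3 \<times> 2)^(3 \<times> 2)" where
  "\<tau> = matrix (\<lambda>v. proj (T *v v))"

lemma \<tau>_apply: "\<tau> *v v = proj (T *v v)"
proof -
  have "linear (\<lambda>v. proj (T *v v))"
    using linear_compose[OF matrix_vector_mul_linear linear_proj, of T] by (simp add: o_def)
  from fun_cong[OF matrix_vector_mul(2)[OF this]] show ?thesis by (simp add: \<tau>_def)
qed

lemma \<tau>_in_W: "\<tau> *v w \<in> W"
  by (simp add: \<tau>_apply proj_in_W)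

text \<open>Since \<open>L\<close> is \<open>T\<close>-invariant, \<open>T\<close> may be applied before or after passing to the quotient.\<close>

lemma \<tau>_proj: "\<tau> *v proj v = proj (T *v v)"
proof -
  have "T *v v - T *v proj v \<in> L"
    using T_span_pair[OF proj_cong_L] by (simp add: T_simps)
  then have "T *v v - \<tau> *v proj v \<in> L"
    using span_add[OF _ proj_cong_L, of _ "T *v proj v"] by (fastforce simp: \<tau>_apply)
  then show ?thesis
    using proj_unique[OF \<tau>_in_W] by metis
qed

lemma \<tau>_\<tau>: 
  assumes "w \<in> W" shows "\<tau> *v (\<tau> *v w) = s *\<^sub>R w"
proof -
  have "\<tau> *v (\<tau> *v w) = proj (s *\<^sub>R w)"
    by (simp add: \<tau>_apply[of w] \<tau>_proj T_T)
  also have "\<dots> = s *\<^sub>R w"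
    using assms by (intro proj_unique subspace_scale[OF subspace_W]) (auto simp: span_zero)
  finally show ?thesis .
qed

text \<open>The unique \<open>A\<close>-linear map from \<open>L\<close> to \<open>\<real>\<^sup>6 / L\<close> that sends \<open>x\<^sub>0\<close> to \<open>w\<close>; it sends \<open>T x\<^sub>0\<close> to \<open>\<tau> w\<close>.\<close>

definition \<Phi> :: "R6 \<Rightarrow> real^(3 \<times> 2)^(3 \<times> 2)" where
  "\<Phi> w = (\<chi> i j. w $ i * \<alpha> $ j + (\<tau> *v w) $ i * \<beta> $ j)"

lemma \<Phi>_apply: "\<Phi> w *v v = (\<alpha> \<bullet> v) *\<^sub>R w + (\<beta> \<bullet> v) *\<^sub>R (\<tau> *v w)"
  by (simp add: \<Phi>_def matrix_vector_mult_def[of "\<chi> i j. _ i j"] vec_eq_iff inner_vec_def sum.distrib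
      sum_distrib_left sum_distrib_right algebra_simps)

lemma \<Phi>_x\<^sub>0 [simp]: "\<Phi> w *v x\<^sub>0 = w" and \<Phi>_y\<^sub>0 [simp]: "\<Phi> w *v y\<^sub>0 = \<tau> *v w"
  by (simp_all add: \<Phi>_apply)

lemma linear_\<Phi>: "linear \<Phi>"
  by (rule linearI) (simp_all add: vec_eq_iff \<Phi>_def matrix_vector_right_distrib
      matrix_vector_mult_scaleR algebra_simps)

text \<open>The lines generated by \<open>x\<^sub>0 + t w\<close> form a curve in \<open>K\<close> with this velocity, as long as \<open>t\<close> is so
small that \<open>x\<^sub>0 + t w\<close> is still a free generator.\<close>

lemma \<Phi>_tangent:
  assumes w: "w \<in> W"
  shows "\<Phi> w \<in> tangent_space K L"
proof -
  define a where "a t = x\<^sub>0 + t *\<^sub>R w" for t :: real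
  define b where "b t = y\<^sub>0 + t *\<^sub>R (T *v w)" for t :: real
  have Ta: "T *v a t = b t" for t
    by (simp add: a_def b_def T_simps)
  have lin: "linear (\<lambda>t. t *\<^sub>R v)" for v :: R6
    by (rule linearI) (simp_all add: algebra_simps)
  have "open {t. \<beta> \<bullet> b t \<noteq> 0}"
    unfolding b_def by (intro open_Collect_neq continuous_intros)
  moreover have "0 \<in> {t. \<beta> \<bullet> b t \<noteq> 0}" by (simp add: b_def)
  ultimately obtain \<delta> where \<delta>: "\<delta> > 0" "ball 0 \<delta> \<subseteq> {t. \<beta> \<bullet> b t \<noteq> 0}"
    by (rule openE)
  have in_K: "span {a t, b t} \<in> K" if "t \<in> {-\<delta><..<\<delta>}" for t
  proof -
    have "\<beta> \<bullet> b t \<noteq> 0" using that \<delta>(2) by (auto simp: subset_iff dist_real_def)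
    then have "area (a t) (b t) \<noteq> 0"
      using w by (simp add: minor_def a_def W_iff inner_right_distrib)
    then show ?thesis using area_nonzero_iff[of "a t" "b t"] by (auto simp: K_def simp flip: Ta)
  qed
  have smooth: "smooth_on {-\<delta><..<\<delta>} a" "smooth_on {-\<delta><..<\<delta>} b"
    unfolding a_def b_def by (intro smooth_on_affine lin)+
  have d: "vector_derivative a (at 0) = w" "vector_derivative b (at 0) = T *v w"
    unfolding a_def b_def by (rule vector_derivative_at; auto intro!: derivative_eq_intros)+
  have "\<forall>x\<in>W. \<Phi> w *v x = 0" by (auto simp: W_iff \<Phi>_apply)
  moreover have "\<forall>x. \<Phi> w *v x \<in> W"
    unfolding \<Phi>_apply using w \<tau>_in_W subspace_W by (auto intro: subspace_add subspace_scale)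
  moreover have "vector_derivative a (at 0) - \<Phi> w *v a 0 \<in> L"
    unfolding d by (simp add: a_def span_zero)
  moreover have "vector_derivative b (at 0) - \<Phi> w *v b 0 \<in> L"
    unfolding d by (simp add: b_def \<tau>_apply proj_cong_L)
  moreover have "span {a 0, b 0} = L" by (simp add: a_def b_def)
  ultimately show ?thesis
    using \<delta>(1) in_K smooth unfolding tangent_space_def by blast
qed

text \<open>Along a curve in \<open>K\<close> spanned by \<open>a\<close> and \<open>b\<close>, the vector \<open>T c\<close> stays in the moving line if \<open>c\<close> does.
Comparing its derivative \<open>T c'\<close> with those of \<open>a\<close> and \<open>b\<close> modulo \<open>L\<close> shows that \<open>\<phi>\<close> commutes with \<open>T\<close>.\<close>

lemma tangent_commutes:
  assumes K: "\<And>t. t \<in> {-\<delta><..<\<delta>} \<Longrightarrow> span {a t, b t} \<in> K" and \<delta>: "0 < \<delta>"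
    and L: "span {a 0, b 0} = L"
    and a: "(a has_vector_derivative a') (at 0)" "a' - \<phi> *v a 0 \<in> L"
    and b: "(b has_vector_derivative b') (at 0)" "b' - \<phi> *v b 0 \<in> L"
    and c: "(c has_vector_derivative c') (at 0)" "c' - \<phi> *v c 0 \<in> L"
    and c_mem: "\<And>t. c t \<in> span {a t, b t}"
  shows "T *v (\<phi> *v c 0) - \<phi> *v (T *v c 0) \<in> L"
proof -
  let ?z = "\<lambda>t. T *v c t"
  have z: "(?z has_vector_derivative T *v c') (at 0)"
    using c(1) by (rule bounded_linear.has_vector_derivative[OF matrix_vector_mul_bounded_linear])
  have z_mem: "?z t \<in> span {a t, b t}" if "t \<in> {-\<delta><..<\<delta>}" for t
    using T_line[OF K[OF that] c_mem] .
  define D where "D = area (a 0) (b 0)"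
  define P where "P = area (?z 0) (b 0)"
  define Q where "Q = area (a 0) (?z 0)"
  have "L \<in> lines" using L_in_K K_subset_lines by blast
  then have "dim (span {a 0, b 0}) = 2" unfolding L by (simp add: lines_def)
  then have "lin_pair (a 0) (b 0)" by (simp only: dim_span_pair_iff)
  moreover have "span {a 0, b 0} \<inter> W = {0}"
    unfolding L using L_Int_W span_zero subspace_0[OF subspace_W] by blast
  ultimately have "D \<noteq> 0" unfolding D_def area_nonzero_iff by blast
  have zD: "D *\<^sub>R ?z 0 = P *\<^sub>R a 0 + Q *\<^sub>R b 0"
    unfolding D_def P_def Q_def by (intro cramer_plane z_mem) (use \<delta> in auto)
  have e: "D *\<^sub>R (T *v c') - (P *\<^sub>R a' + Q *\<^sub>R b') \<in> L"
    unfolding D_def P_def Q_def L[symmetric]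
    by (rule derivative_in_moving_plane[OF z a(1) b(1), of "{-\<delta><..<\<delta>}"]) (use z_mem \<delta> in auto)
  have "D *\<^sub>R (T *v (\<phi> *v c 0) - \<phi> *v (T *v c 0)) =
      D *\<^sub>R (T *v (\<phi> *v c 0)) - \<phi> *v (D *\<^sub>R ?z 0)"
    by (simp add: matrix_vector_mult_scaleR scaleR_diff_right)
  also have "\<dots> = D *\<^sub>R (T *v c') - (P *\<^sub>R a' + Q *\<^sub>R b')
      - D *\<^sub>R (T *v (c' - \<phi> *v c 0)) + (P *\<^sub>R (a' - \<phi> *v a 0) + Q *\<^sub>R (b' - \<phi> *v b 0))"
    unfolding zD by (simp add: matrix_vector_mult_scaleR matrix_vector_right_distrib
        matrix_vector_mult_diff_distrib algebra_simps)
  also have "\<dots> \<in> L"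
    by (rule span_add[OF span_diff[OF e span_scale[OF T_span_pair[OF c(2)]]]
          span_add[OF span_scale[OF a(2)] span_scale[OF b(2)]]])
  finally show ?thesis using \<open>D \<noteq> 0\<close> by (rule scaleR_memD[OF subspace_span])
qed

lemma smooth_on_has_vector_derivative:
  fixes a :: "real \<Rightarrow> 'a::real_normed_vector"
  assumes "smooth_on U a" "t \<in> U"
  shows "(a has_vector_derivative vector_derivative a (at t)) (at t)"
  using assms(1)
proof cases
  case (1 f')
  then have "a differentiable (at t)" using assms(2) differentiable_def by blast
  then show ?thesis by (simp add: vector_derivative_works)
qed

text \<open>The two spanning curves themselves are admissible for \<open>c\<close> in \<open>tangent_commutes\<close>, so \<open>\<phi>\<close>
commutes with \<open>T\<close> modulo \<open>L\<close> on all of \<open>L\<close> and is determined by \<open>\<phi> x\<^sub>0\<close>.\<close>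

lemma tangent_space_eq: "tangent_space K L = \<Phi> ` W"
proof (intro subset_antisym subsetI)
  fix \<phi> assume "\<phi> \<in> tangent_space K L"
  then obtain \<delta> and a b :: "real \<Rightarrow> R6" where
    W0: "\<forall>x\<in>W. \<phi> *v x = 0" and in_W: "\<forall>x. \<phi> *v x \<in> W" and \<delta>: "\<delta> > 0" and
    sm: "smooth_on {-\<delta><..<\<delta>} a" "smooth_on {-\<delta><..<\<delta>} b" and
    K: "\<forall>t\<in>{-\<delta><..<\<delta>}. span {a t, b t} \<in> K" and
    L: "span {a 0, b 0} = L" and
    d: "vector_derivative a (at 0) - \<phi> *v a 0 \<in> L" "vector_derivative b (at 0) - \<phi> *v b 0 \<in> L"
    unfolding tangent_space_def by blast
  have dab: "(a has_vector_derivative vector_derivative a (at 0)) (at 0)"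
    "(b has_vector_derivative vector_derivative b (at 0)) (at 0)"
    using smooth_on_has_vector_derivative[OF sm(1), of 0] smooth_on_has_vector_derivative[OF sm(2), of 0] \<delta>
    by simp_all
  have a: "T *v (\<phi> *v a 0) - \<phi> *v (T *v a 0) \<in> L"
    by (rule tangent_commutes[OF K[rule_format] \<delta> L dab(1) d(1) dab(2) d(2) dab(1) d(1)]) (auto simp: span_base)
  have b: "T *v (\<phi> *v b 0) - \<phi> *v (T *v b 0) \<in> L"
    by (rule tangent_commutes[OF K[rule_format] \<delta> L dab(1) d(1) dab(2) d(2) dab(2) d(2)]) (auto simp: span_base)
  have "x\<^sub>0 \<in> span {a 0, b 0}" by (simp add: L span_base)
  then obtain p q where x: "x\<^sub>0 = p *\<^sub>R a 0 + q *\<^sub>R b 0" by (rule in_span_pairE)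
  have "T *v (\<phi> *v x\<^sub>0) - \<phi> *v y\<^sub>0 =
      p *\<^sub>R (T *v (\<phi> *v a 0) - \<phi> *v (T *v a 0)) + q *\<^sub>R (T *v (\<phi> *v b 0) - \<phi> *v (T *v b 0))"
    unfolding x by (simp add: matrix_vector_mult_scaleR matrix_vector_right_distrib algebra_simps)
  also have "\<dots> \<in> L" using a b by (intro span_add span_scale)
  finally have m: "T *v (\<phi> *v x\<^sub>0) - \<phi> *v y\<^sub>0 \<in> L" .
  have \<phi>y: "\<phi> *v y\<^sub>0 = \<tau> *v (\<phi> *v x\<^sub>0)"
    unfolding \<tau>_apply using proj_unique[OF _ m] in_W by metis
  have "\<phi> *v v = \<Phi> (\<phi> *v x\<^sub>0) *v v" for v
  proof -
    have "\<phi> *v v = \<phi> *v ((\<alpha> \<bullet> v) *\<^sub>R x\<^sub>0 + (\<beta> \<bullet> v) *\<^sub>R y\<^sub>0 + proj v)"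
      by (simp add: proj_def)
    also have "\<dots> = (\<alpha> \<bullet> v) *\<^sub>R (\<phi> *v x\<^sub>0) + (\<beta> \<bullet> v) *\<^sub>R (\<phi> *v y\<^sub>0)"
      by (simp add: matrix_vector_mult_scaleR matrix_vector_right_distrib W0 proj_in_W)
    finally show ?thesis by (simp add: \<Phi>_apply \<phi>y)
  qed
  then have "\<phi> = \<Phi> (\<phi> *v x\<^sub>0)" by (intro matrix_eq[THEN iffD2] allI)
  then show "\<phi> \<in> \<Phi> ` W" using in_W by (intro image_eqI) auto
qed (use \<Phi>_tangent in blast)

end

section \<open>Complexification\<close>

definition cvec :: "real^'n \<Rightarrow> complex^'n" where
  "cvec x = (\<chi> i. of_real (x $ i))"

abbreviation cmat :: "real^'n^'m \<Rightarrow> complex^'n^'m" where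
  "cmat \<equiv> map_matrix of_real"

lemma cvec_simps [simp]: "cvec x $ i = of_real (x $ i)" "cvec (x + y) = cvec x + cvec y"
  "cvec (c *\<^sub>R x) = of_real c *s cvec x" "cvec 0 = 0"
  by (simp_all add: cvec_def vec_eq_iff)

lemma cmat_mult_cvec: "cmat A *v cvec x = cvec (A *v x)"
  by (simp add: matrix_vector_mult_def vec_eq_iff)

lemma matrix_mult_cvec:
  "M *v cvec x = cvec (map_matrix Re M *v x) + \<i> *s cvec (map_matrix Im M *v x)"
  by (simp add: matrix_vector_mult_def vec_eq_iff complex_eq_iff)

lemma cvec_Re_Im: "v = cvec (\<chi> i. Re (v $ i)) + \<i> *s cvec (\<chi> i. Im (v $ i))"
  by (simp add: vec_eq_iff complex_eq_iff)

lemma Re_cvec_comb: "(\<chi> i. Re ((c *s cvec x + d *s cvec y) $ i)) = Re c *\<^sub>R x + Re d *\<^sub>R y"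
  and Im_cvec_comb: "(\<chi> i. Im ((c *s cvec x + d *s cvec y) $ i)) = Im c *\<^sub>R x + Im d *\<^sub>R y"
  by (simp_all add: vec_eq_iff)

lemma cplx_span_pair: "v \<in> cplx (span {x, y}) \<longleftrightarrow> (\<exists>p q. v = p *s cvec x + q *s cvec y)"
proof
  assume "v \<in> cplx (span {x, y})"
  then have re: "(\<chi> i. Re (v $ i)) \<in> span {x, y}" and im: "(\<chi> i. Im (v $ i)) \<in> span {x, y}"
    by (simp_all add: cplx_def)
  obtain p q where re: "(\<chi> i. Re (v $ i)) = p *\<^sub>R x + q *\<^sub>R y" using re by (rule in_span_pairE)
  obtain p' q' where im: "(\<chi> i. Im (v $ i)) = p' *\<^sub>R x + q' *\<^sub>R y" using im by (rule in_span_pairE)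
  have "v = Complex p p' *s cvec x + Complex q q' *s cvec y"
    by (subst cvec_Re_Im[of v], unfold re im) (simp add: vec_eq_iff complex_eq_iff)
  then show "\<exists>p q. v = p *s cvec x + q *s cvec y" by blast
next
  assume "\<exists>p q. v = p *s cvec x + q *s cvec y"
  then show "v \<in> cplx (span {x, y})"
    by (auto simp: cplx_def Re_cvec_comb Im_cvec_comb in_span_pair simp del: vector_add_component
        vector_smult_component)
qed

lemma vec_span_singleton: "vec.span {v} = {c *s v | c. True}"
  by (auto simp: vec.span_singleton)

lemma cplx_span_singleton: "cplx (span {x}) = vec.span {cvec x}"
proof -
  have "v \<in> cplx (span {x, 0}) \<longleftrightarrow> v \<in> vec.span {cvec x}" for v
    unfolding cplx_span_pair by (auto simp: vec_span_singleton)
  moreover have "span {x, 0} = span {x}" by (simp add: insert_commute)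
  ultimately show ?thesis by auto
qed

lemma cvec_pair_independent:
  assumes "lin_pair x y" "p *s cvec x + q *s cvec y = 0"
  shows "p = 0 \<and> q = 0"
proof -
  from assms(2) have "Re p *\<^sub>R x + Re q *\<^sub>R y = 0" "Im p *\<^sub>R x + Im q *\<^sub>R y = 0"
    unfolding Re_cvec_comb[symmetric] Im_cvec_comb[symmetric] by (simp_all add: vec_eq_iff)
  then show ?thesis
    using lin_pairD[OF assms(1)] by (auto simp: complex_eq_iff)
qed

section \<open>Determinants and bases\<close>

lemma det_4_block_diagonal:
  fixes A :: "'a::comm_ring_1^4^4"
  assumes "A$1$3 = 0" "A$1$4 = 0" "A$2$3 = 0" "A$2$4 = 0"
    "A$3$1 = 0" "A$3$2 = 0" "A$4$1 = 0" "A$4$2 = 0"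
  shows "det A = (A$1$1 * A$2$2 - A$1$2 * A$2$1) * (A$3$3 * A$4$4 - A$3$4 * A$4$3)"
proof -
  have f1234: "finite {2::4, 3, 4}" "1 \<notin> {2::4, 3, 4}"
    by auto
  have f234: "finite {3::4, 4}" "2 \<notin> {3::4, 4}"
    by auto
  have f34: "finite {4::4}" "3 \<notin> {4::4}"
    by auto
  show ?thesis
    unfolding det_def UNIV_4
    unfolding sum_over_permutations_insert[OF f1234]
    unfolding sum_over_permutations_insert[OF f234]
    unfolding sum_over_permutations_insert[OF f34]
    unfolding permutes_sing
    by (simp add: sign_swap_id permutation_swap_id permutation_compose sign_compose sign_id
        swap_id_eq assms algebra_simps)
qed

lemma det_cmat: "det (cmat A :: complex^'n^'n) = of_real (det A)"
  by (simp add: det_def)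

lemma family_independent:
  fixes w :: "'i::finite \<Rightarrow> 'v::real_vector"
  assumes "\<And>z. (\<Sum>i\<in>UNIV. z i *\<^sub>R w i) = 0 \<Longrightarrow> \<forall>i. z i = 0"
  shows "inj w" "independent (range w)"
proof -
  show i: "inj w"
  proof (rule injI, rule ccontr)
    fix i j assume e: "w i = w j" "i \<noteq> j"
    have "(\<Sum>k\<in>UNIV. ((if k = i then 1 else 0) - (if k = j then 1 else 0)) *\<^sub>R w k) = 0"
      by (simp add: scaleR_diff_left sum_subtractf if_distrib[of "\<lambda>c. c *\<^sub>R _"] e(1) cong: if_cong)
    from spec[OF assms[OF this], of i] show False using e(2) by simp
  qed
  show "independent (range w)"
  proof
    assume "dependent (range w)"
    then obtain u v where "v \<in> range w" "u v \<noteq> 0" "(\<Sum>v\<in>range w. u v *\<^sub>R v) = 0"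
      by (auto simp: dependent_finite)
    then show False using assms[of "u \<circ> w"] i by (auto simp: sum.reindex)
  qed
qed

lemma basis_of_family:
  fixes w :: "'i::finite \<Rightarrow> 'v::euclidean_space"
  assumes "\<And>z. (\<Sum>i\<in>UNIV. z i *\<^sub>R w i) = 0 \<Longrightarrow> \<forall>i. z i = 0"
    and "subspace S" "range w \<subseteq> S" "dim S = CARD('i)"
  shows "basis_of w S"
proof -
  have i: "inj w" "independent (range w)"
    by (rule family_independent, rule assms(1), assumption)+
  have "dim (span (range w)) = dim S"
    using i by (simp add: dim_eq_card_independent card_image assms(4))
  then have "span (range w) = S"
    using assms(2,3) by (intro subspace_dim_equal span_minimal) auto
  then show ?thesis using i by (simp add: basis_of_def)
qed

lemma basis_of_linear_image:
  assumes "basis_of w S" "linear f" "inj_on f S"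
  shows "basis_of (f \<circ> w) (f ` S)"
proof -
  have w: "inj w" "independent (range w)" "span (range w) = S"
    using assms(1) by (simp_all add: basis_of_def)
  have r: "range (f \<circ> w) = f ` range w" by (simp add: image_comp)
  have "range w \<subseteq> S" unfolding w(3)[symmetric] by (rule span_superset)
  then have "inj (f \<circ> w)"
    by (intro comp_inj_on w(1) inj_on_subset[OF assms(3)])
  moreover have "independent (f ` range w)"
    by (rule linear_independent_injective_image[OF assms(2) w(2)]) (simp add: w(3) assms(3))
  moreover have "span (f ` range w) = f ` S"
    by (simp add: linear_span_image[OF assms(2)] w(3))
  ultimately show ?thesis unfolding basis_of_def r by blast
qed

text \<open>A kernel vector of the Gram matrix gives a combination of the family that is orthogonal to all
its members, hence to itself.\<close>

lemma gram_det_nonzero: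
  fixes w :: "'i::finite \<Rightarrow> 'v::real_inner"
  assumes "\<And>z. (\<Sum>i\<in>UNIV. z i *\<^sub>R w i) = 0 \<Longrightarrow> \<forall>i. z i = 0"
  shows "det (\<chi> i j. w i \<bullet> w j) \<noteq> 0"
proof -
  let ?G = "\<chi> i j. w i \<bullet> w j"
  have "x = 0" if "?G *v x = 0" for x
  proof -
    let ?v = "\<Sum>j\<in>UNIV. x $ j *\<^sub>R w j"
    have "w i \<bullet> ?v = (?G *v x) $ i" for i
      by (simp add: matrix_vector_mult_def inner_sum_right mult.commute)
    then have "w i \<bullet> ?v = 0" for i using that by simp
    then have "?v \<bullet> ?v = 0" by (subst inner_sum_left) simp
    then show ?thesis using assms[of "($) x"] by (simp add: vec_eq_iff)
  qed
  then have "invertible ?G"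
    by (simp add: invertible_left_inverse matrix_left_invertible_ker)
  then show ?thesis by (simp add: invertible_det_nz)
qed

section \<open>The focal form and the foci\<close>

context line_frame
begin

text \<open>The basis of the quotient from \<open>free_quotient\<close>, projected to \<open>W\<close>.\<close>

lemma W_basis:
  obtains u v where "u \<in> W" "v \<in> W"
    "\<And>c\<^sub>1 c\<^sub>2 d\<^sub>1 d\<^sub>2. c\<^sub>1 *\<^sub>R u + c\<^sub>2 *\<^sub>R (\<tau> *v u) + d\<^sub>1 *\<^sub>R v + d\<^sub>2 *\<^sub>R (\<tau> *v v) = 0 \<Longrightarrow>
      c\<^sub>1 = 0 \<and> c\<^sub>2 = 0 \<and> d\<^sub>1 = 0 \<and> d\<^sub>2 = 0"
proof -
  obtain u v where uv: "\<And>c\<^sub>1 c\<^sub>2 d\<^sub>1 d\<^sub>2.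
      c\<^sub>1 *\<^sub>R u + c\<^sub>2 *\<^sub>R (T *v u) + d\<^sub>1 *\<^sub>R v + d\<^sub>2 *\<^sub>R (T *v v) \<in> L \<Longrightarrow>
      c\<^sub>1 = 0 \<and> c\<^sub>2 = 0 \<and> d\<^sub>1 = 0 \<and> d\<^sub>2 = 0"
    using free_quotient[OF generator] unfolding free_quotient_def by blast
  have "c\<^sub>1 = 0 \<and> c\<^sub>2 = 0 \<and> d\<^sub>1 = 0 \<and> d\<^sub>2 = 0"
    if z: "c\<^sub>1 *\<^sub>R proj u + c\<^sub>2 *\<^sub>R (\<tau> *v proj u) + d\<^sub>1 *\<^sub>R proj v + d\<^sub>2 *\<^sub>R (\<tau> *v proj v) = 0"
    for c\<^sub>1 c\<^sub>2 d\<^sub>1 d\<^sub>2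
  proof -
    let ?s = "c\<^sub>1 *\<^sub>R u + c\<^sub>2 *\<^sub>R (T *v u) + d\<^sub>1 *\<^sub>R v + d\<^sub>2 *\<^sub>R (T *v v)"
    have "proj ?s = 0"
      using z by (simp add: \<tau>_proj linear_add[OF linear_proj] linear_scale[OF linear_proj])
    then have "?s \<in> L" using proj_cong_L[of ?s] by simp
    then show ?thesis by (rule uv)
  qed
  with proj_in_W that show ?thesis by blast
qed

text \<open>The basis \<open>u, \<tau> u, v, \<tau> v\<close> of \<open>W\<close> serves three times: as basis \<open>C\<close> of \<open>W\<close>, through \<open>\<Phi>\<close> as basis \<open>B\<close>
of the tangent space, and for writing \<open>p + q \<tau>\<close> as a block matrix \<open>N\<close>.  The focal form is then the
determinant of the product of the Gram matrix \<open>G\<close> of the basis with \<open>N\<close>, whose two blocks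
have determinant \<open>p\<^sup>2 - s q\<^sup>2\<close>.\<close>

lemma focal_form_eq:
  obtains B g where "basis_of B (tangent_space K L)" "\<exists>C. basis_of C W \<and> g \<noteq> 0 \<and>
    (\<forall>p q. focal_form B C (p *s cvec x\<^sub>0 + q *s cvec y\<^sub>0) = g * (p\<^sup>2 - of_real s * q\<^sup>2)\<^sup>2)"
proof -
  obtain u v where uv: "u \<in> W" "v \<in> W" and
    ind: "\<And>c\<^sub>1 c\<^sub>2 d\<^sub>1 d\<^sub>2. c\<^sub>1 *\<^sub>R u + c\<^sub>2 *\<^sub>R (\<tau> *v u) + d\<^sub>1 *\<^sub>R v + d\<^sub>2 *\<^sub>R (\<tau> *v v) = 0 \<Longrightarrow>
      c\<^sub>1 = 0 \<and> c\<^sub>2 = 0 \<and> d\<^sub>1 = 0 \<and> d\<^sub>2 = 0"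
    by (rule W_basis) blast
  define w :: "4 \<Rightarrow> R6" where
    "w j = (if j = 1 then u else if j = 2 then \<tau> *v u else if j = 3 then v else \<tau> *v v)" for j
  have w_simps: "w 1 = u" "w 2 = \<tau> *v u" "w 3 = v" "w 4 = \<tau> *v v"
    by (simp_all add: w_def)
  have w_W: "w j \<in> W" for j using uv \<tau>_in_W by (simp add: w_def)
  have w_ind: "\<forall>i. z i = 0" if "(\<Sum>i\<in>UNIV. z i *\<^sub>R w i) = 0" for z
    using ind[of "z 1" "z 2" "z 3" "z 4"] that by (simp add: sum_4 w_simps forall_4)
  have w_basis: "basis_of w W"
    using w_W dim_W by (intro basis_of_family w_ind subspace_W) auto
  have inj: "inj_on \<Phi> S" for S
    by (rule inj_onI) (metis \<Phi>_x\<^sub>0)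
  have B_basis: "basis_of (\<Phi> \<circ> w) (tangent_space K L)"
    unfolding tangent_space_eq by (rule basis_of_linear_image[OF w_basis linear_\<Phi> inj])
  define G where "G = (\<chi> i j. w i \<bullet> w j)"
  define N :: "complex \<Rightarrow> complex \<Rightarrow> complex^4^4" where "N p q = (\<chi> i j.
    if i = j then p
    else if i = 2 \<and> j = 1 \<or> i = 4 \<and> j = 3 then q
    else if i = 1 \<and> j = 2 \<or> i = 3 \<and> j = 4 then of_real s * q
    else 0)" for p q
  have det_N: "det (N p q) = (p\<^sup>2 - of_real s * q\<^sup>2)\<^sup>2" for p q
    by (subst det_4_block_diagonal) (simp_all add: N_def power2_eq_square algebra_simps)
  have "focal_form (\<Phi> \<circ> w) w (p *s cvec x\<^sub>0 + q *s cvec y\<^sub>0) =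
      of_real (det G) * (p\<^sup>2 - of_real s * q\<^sup>2)\<^sup>2" for p q
  proof -
    have "(cmat (\<Phi> (w j)) *v (p *s cvec x\<^sub>0 + q *s cvec y\<^sub>0)) = p *s cvec (w j) + q *s cvec (\<tau> *v w j)" for j
      by (simp add: matrix_vector_right_distrib vector_scalar_commute cmat_mult_cvec)
    then have "focal_form (\<Phi> \<circ> w) w (p *s cvec x\<^sub>0 + q *s cvec y\<^sub>0) =
        det (\<chi> i j. p * of_real (w i \<bullet> w j) + q * of_real (w i \<bullet> (\<tau> *v w j)))"
      by (simp add: focal_form_def inner_vec_def sum.distrib sum_distrib_left algebra_simps)
    also have "(\<chi> i j. p * of_real (w i \<bullet> w j) + q * of_real (w i \<bullet> (\<tau> *v w j))) = cmat G ** N p q"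
      by (simp add: vec_eq_iff forall_4 matrix_matrix_mult_def sum_4 G_def N_def w_simps \<tau>_\<tau> uv
          algebra_simps)
    finally show ?thesis by (simp add: det_mul det_N det_cmat o_def)
  qed
  moreover have "of_real (det G) \<noteq> (0::complex)"
    unfolding G_def of_real_eq_0_iff by (rule gram_det_nonzero[OF w_ind])
  ultimately show ?thesis
    using w_basis by (intro that[OF B_basis]) blast
qed

text \<open>On a tangent vector with value \<open>\<omega>\<close> at \<open>x\<^sub>0\<close>, evaluation at \<open>v\<close> gives \<open>(p + q \<tau>) \<omega>\<close>, and
\<open>(p - q \<tau>) (p + q \<tau>) = p\<^sup>2 - s q\<^sup>2\<close>.  If this number is nonzero, then \<open>\<omega> = 0\<close>; if it is zero, then
\<open>\<omega> = (p - q \<tau>) u\<close> is annihilated, and it is nonzero since \<open>u\<close> and \<open>\<tau> u\<close> are independent.\<close>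

lemma complex_focus_iff:
  assumes v: "v = p *s cvec x\<^sub>0 + q *s cvec y\<^sub>0" "v \<noteq> 0"
  shows "(\<exists>\<phi>\<in>cplx_mats (tangent_space K L). \<phi> \<noteq> 0 \<and> \<phi> *v v = 0) \<longleftrightarrow> p\<^sup>2 = of_real s * q\<^sup>2"
proof
  assume "\<exists>\<phi>\<in>cplx_mats (tangent_space K L). \<phi> \<noteq> 0 \<and> \<phi> *v v = 0"
  then obtain \<phi> w w' where \<phi>: "\<phi> \<noteq> 0" "\<phi> *v v = 0" and
    w: "w \<in> W" "w' \<in> W" "map_matrix Re \<phi> = \<Phi> w" "map_matrix Im \<phi> = \<Phi> w'"
    unfolding cplx_mats_def tangent_space_eq by blast
  define \<omega> where "\<omega> = cvec w + \<i> *s cvec w'"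
  have \<tau>\<omega>: "cmat \<tau> *v \<omega> = cvec (\<tau> *v w) + \<i> *s cvec (\<tau> *v w')"
    by (simp add: \<omega>_def matrix_vector_right_distrib vector_scalar_commute cmat_mult_cvec)
  have \<phi>_v: "\<phi> *v v = p *s \<omega> + q *s (cmat \<tau> *v \<omega>)"
    unfolding \<tau>\<omega> by (simp add: v(1) matrix_vector_right_distrib vector_scalar_commute
        matrix_mult_cvec w \<omega>_def)
  have "cmat \<tau> *v (cmat \<tau> *v \<omega>) = of_real s *s \<omega>"
    by (simp add: \<omega>_def matrix_vector_right_distrib vector_scalar_commute cmat_mult_cvec
        \<tau>_\<tau> w(1,2) vector_add_ldistrib mult.commute)
  then have \<tau>_\<phi>_v: "cmat \<tau> *v (\<phi> *v v) = p *s (cmat \<tau> *v \<omega>) + (of_real s * q) *s \<omega>"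
    unfolding \<phi>_v by (simp add: matrix_vector_right_distrib vector_scalar_commute mult.commute)
  then have "p *s (\<phi> *v v) - q *s (cmat \<tau> *v (\<phi> *v v)) = (p\<^sup>2 - of_real s * q\<^sup>2) *s \<omega>"
    unfolding \<tau>_\<phi>_v unfolding \<phi>_v by (simp add: vec_eq_iff power2_eq_square algebra_simps)
  then have e: "(p\<^sup>2 - of_real s * q\<^sup>2) *s \<omega> = 0" by (simp add: \<phi>(2))
  have "\<omega> \<noteq> 0"
  proof
    assume "\<omega> = 0"
    then have "w = 0" "w' = 0" by (auto simp: \<omega>_def vec_eq_iff complex_eq_iff)
    then have "map_matrix Re \<phi> = 0" "map_matrix Im \<phi> = 0"
      using w linear_0[OF linear_\<Phi>] by auto
    then show False using \<phi>(1) by (auto simp: vec_eq_iff complex_eq_iff)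
  qed
  with e show "p\<^sup>2 = of_real s * q\<^sup>2" by simp
next
  assume pq: "p\<^sup>2 = of_real s * q\<^sup>2"
  obtain u where u: "u \<in> W" and
    ind: "\<And>c\<^sub>1 c\<^sub>2. c\<^sub>1 *\<^sub>R u + c\<^sub>2 *\<^sub>R (\<tau> *v u) = 0 \<Longrightarrow> c\<^sub>1 = 0 \<and> c\<^sub>2 = 0"
    using W_basis by (metis add.right_neutral scale_zero_left)
  \<comment> \<open>The real and imaginary parts of \<open>(p - q \<tau>) u\<close>.\<close>
  define w where "w = Re p *\<^sub>R u + (- Re q) *\<^sub>R (\<tau> *v u)"
  define w' where "w' = Im p *\<^sub>R u + (- Im q) *\<^sub>R (\<tau> *v u)"
  have w: "w \<in> W" "w' \<in> W"
    unfolding w_def w'_def using u \<tau>_in_W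
    by (auto intro!: subspace_add[OF subspace_W] subspace_diff[OF subspace_W] subspace_scale[OF subspace_W])
  define \<phi> :: "complex^(3 \<times> 2)^(3 \<times> 2)"
    where "\<phi> = (\<chi> i j. Complex (\<Phi> w $ i $ j) (\<Phi> w' $ i $ j))"
  have re_im: "map_matrix Re \<phi> = \<Phi> w" "map_matrix Im \<phi> = \<Phi> w'"
    by (simp_all add: \<phi>_def vec_eq_iff)
  have \<omega>: "cvec w + \<i> *s cvec w' = p *s cvec u - q *s cvec (\<tau> *v u)"
    by (simp add: w_def w'_def vec_eq_iff complex_eq_iff)
  have \<tau>\<omega>: "cvec (\<tau> *v w) + \<i> *s cvec (\<tau> *v w') = p *s cvec (\<tau> *v u) - (of_real s * q) *s cvec u"
    by (simp add: w_def w'_def matrix_vector_right_distrib matrix_vector_mult_scaleR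
        matrix_vector_mult_diff_distrib \<tau>_\<tau> u vec_eq_iff complex_eq_iff)
  have "\<phi> *v v = p *s (cvec w + \<i> *s cvec w') + q *s (cvec (\<tau> *v w) + \<i> *s cvec (\<tau> *v w'))"
    by (simp add: v(1) matrix_vector_right_distrib vector_scalar_commute matrix_mult_cvec re_im)
  also have "\<dots> = (p\<^sup>2 - of_real s * q\<^sup>2) *s cvec u"
    unfolding \<omega> \<tau>\<omega> by (simp add: vec_eq_iff power2_eq_square algebra_simps)
  finally have "\<phi> *v v = 0" by (simp add: pq)
  moreover have "\<phi> \<noteq> 0"
  proof
    assume "\<phi> = 0"
    then have "\<Phi> w = 0" "\<Phi> w' = 0" using re_im by (auto simp: vec_eq_iff)
    then have "w = 0" "w' = 0" using \<Phi>_x\<^sub>0 by (metis matrix_vector_mult_0)+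
    then have "p = 0 \<and> q = 0"
      using ind unfolding w_def w'_def by (metis complex_eq_iff neg_equal_0_iff_equal zero_complex.sel)
    then show False using v by simp
  qed
  moreover have "\<phi> \<in> cplx_mats (tangent_space K L)"
    using w by (simp add: cplx_mats_def re_im tangent_space_eq)
  ultimately show "\<exists>\<phi>\<in>cplx_mats (tangent_space K L). \<phi> \<noteq> 0 \<and> \<phi> *v v = 0" by blast
qed

text \<open>At a real point, the real and imaginary parts of an annihilating complex tangent vector
annihilate as well, so the real and the complex notion of focus agree there.\<close>

lemma real_focus_iff:
  assumes v: "v = p *\<^sub>R x\<^sub>0 + q *\<^sub>R y\<^sub>0" "v \<noteq> 0"
  shows "(\<exists>\<phi>\<in>tangent_space K L. \<phi> \<noteq> 0 \<and> \<phi> *v v = 0) \<longleftrightarrow> p\<^sup>2 = s * q\<^sup>2"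
proof -
  have cv: "cvec v = of_real p *s cvec x\<^sub>0 + of_real q *s cvec y\<^sub>0" by (simp add: v(1))
  have cv0: "cvec v \<noteq> 0" using v(2) by (simp add: vec_eq_iff)
  have "(\<exists>\<phi>\<in>tangent_space K L. \<phi> \<noteq> 0 \<and> \<phi> *v v = 0) \<longleftrightarrow>
      (\<exists>\<phi>\<in>cplx_mats (tangent_space K L). \<phi> \<noteq> 0 \<and> \<phi> *v cvec v = 0)"
  proof
    assume "\<exists>\<phi>\<in>tangent_space K L. \<phi> \<noteq> 0 \<and> \<phi> *v v = 0"
    then obtain \<phi> where \<phi>: "\<phi> \<in> tangent_space K L" "\<phi> \<noteq> 0" "\<phi> *v v = 0" by blast
    have "0 \<in> tangent_space K L"
      unfolding tangent_space_eq using linear_0[OF linear_\<Phi>] subspace_0[OF subspace_W] by (metis image_eqI)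
    moreover have "map_matrix Re (cmat \<phi>) = \<phi>" "map_matrix Im (cmat \<phi>) = 0"
      by (simp_all add: vec_eq_iff)
    ultimately have "cmat \<phi> \<in> cplx_mats (tangent_space K L)"
      using \<phi>(1) by (simp add: cplx_mats_def)
    moreover have "cmat \<phi> \<noteq> 0" using \<phi>(2) by (simp add: vec_eq_iff)
    moreover have "cmat \<phi> *v cvec v = 0" by (simp add: cmat_mult_cvec \<phi>(3))
    ultimately show "\<exists>\<phi>\<in>cplx_mats (tangent_space K L). \<phi> \<noteq> 0 \<and> \<phi> *v cvec v = 0" by blast
  next
    assume "\<exists>\<phi>\<in>cplx_mats (tangent_space K L). \<phi> \<noteq> 0 \<and> \<phi> *v cvec v = 0"
    then obtain \<phi> where \<phi>: "map_matrix Re \<phi> \<in> tangent_space K L" "map_matrix Im \<phi> \<in> tangent_space K L"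
      "\<phi> \<noteq> 0" "\<phi> *v cvec v = 0" by (auto simp: cplx_mats_def)
    from \<phi>(4) have "map_matrix Re \<phi> *v v = 0" "map_matrix Im \<phi> *v v = 0"
      unfolding matrix_mult_cvec by (auto simp: vec_eq_iff complex_eq_iff)
    moreover have "map_matrix Re \<phi> \<noteq> 0 \<or> map_matrix Im \<phi> \<noteq> 0"
      using \<phi>(3) by (auto simp: vec_eq_iff complex_eq_iff)
    ultimately show "\<exists>\<phi>\<in>tangent_space K L. \<phi> \<noteq> 0 \<and> \<phi> *v v = 0" using \<phi>(1,2) by blast
  qed
  also have "\<dots> \<longleftrightarrow> (complex_of_real p)\<^sup>2 = of_real s * (of_real q)\<^sup>2"
    by (rule complex_focus_iff[OF cv cv0])
  also have "\<dots> \<longleftrightarrow> p\<^sup>2 = s * q\<^sup>2"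
    by (metis of_real_eq_iff of_real_mult of_real_power)
  finally show ?thesis .
qed

text \<open>A zero of \<open>p\<^sup>2 - s q\<^sup>2\<close> other than \<open>(0, 0)\<close> has \<open>q \<noteq> 0\<close> and can be normalized to \<open>q = 1\<close>.\<close>

lemma complex_foci_eq:
  "complex_foci K L = {vec.span {r *s cvec x\<^sub>0 + cvec y\<^sub>0} | r. r\<^sup>2 = of_real s}"
proof (intro subset_antisym subsetI)
  fix P assume "P \<in> complex_foci K L"
  then obtain v where v: "P = vec.span {v}" "v \<in> cplx L" "v \<noteq> 0"
    "\<exists>\<phi>\<in>cplx_mats (tangent_space K L). \<phi> \<noteq> 0 \<and> \<phi> *v v = 0"
    unfolding complex_foci_def by blast
  obtain p q where pq: "v = p *s cvec x\<^sub>0 + q *s cvec y\<^sub>0" using v(2) cplx_span_pair by blast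
  have e: "p\<^sup>2 = of_real s * q\<^sup>2" using complex_focus_iff[OF pq v(3)] v(4) by blast
  have "q \<noteq> 0"
  proof
    assume "q = 0"
    with e have "p = 0" by simp
    with \<open>q = 0\<close> pq v(3) show False by simp
  qed
  have "v = q *s ((p / q) *s cvec x\<^sub>0 + cvec y\<^sub>0)"
    using \<open>q \<noteq> 0\<close> by (simp add: pq vec_eq_iff field_simps)
  then have "P = vec.span {(p / q) *s cvec x\<^sub>0 + cvec y\<^sub>0}"
    using v(1) vec.span_image_scale[of "{(p / q) *s cvec x\<^sub>0 + cvec y\<^sub>0}" "\<lambda>_. q"] \<open>q \<noteq> 0\<close> by simp
  moreover have "(p / q)\<^sup>2 = of_real s"
    using e \<open>q \<noteq> 0\<close> by (simp add: power_divide)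
  ultimately show "P \<in> {vec.span {r *s cvec x\<^sub>0 + cvec y\<^sub>0} | r. r\<^sup>2 = of_real s}" by blast
next
  fix P assume "P \<in> {vec.span {r *s cvec x\<^sub>0 + cvec y\<^sub>0} | r. r\<^sup>2 = of_real s}"
  then obtain r where r: "P = vec.span {r *s cvec x\<^sub>0 + cvec y\<^sub>0}" "r\<^sup>2 = of_real s" by blast
  let ?v = "r *s cvec x\<^sub>0 + cvec y\<^sub>0"
  have v: "?v = r *s cvec x\<^sub>0 + 1 *s cvec y\<^sub>0" by simp
  have "?v \<noteq> 0" using cvec_pair_independent[OF generator, of r 1] by auto
  moreover have "?v \<in> cplx L" unfolding cplx_span_pair using v by blast
  ultimately show "P \<in> complex_foci K L"
    using complex_focus_iff[OF v] r unfolding complex_foci_def by auto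
qed

lemma real_foci_eq: "real_foci K L = {span {r *\<^sub>R x\<^sub>0 + y\<^sub>0} | r. r\<^sup>2 = s}"
proof (intro subset_antisym subsetI)
  fix P assume "P \<in> real_foci K L"
  then obtain v where v: "P = span {v}" "v \<in> L" "v \<noteq> 0"
    "\<exists>\<phi>\<in>tangent_space K L. \<phi> \<noteq> 0 \<and> \<phi> *v v = 0"
    unfolding real_foci_def by blast
  obtain p q where pq: "v = p *\<^sub>R x\<^sub>0 + q *\<^sub>R y\<^sub>0" using v(2) by (rule in_span_pairE)
  have e: "p\<^sup>2 = s * q\<^sup>2" using real_focus_iff[OF pq v(3)] v(4) by blast
  have "q \<noteq> 0"
  proof
    assume "q = 0"
    with e have "p = 0" by simp
    with \<open>q = 0\<close> pq v(3) show False by simp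
  qed
  have "v = q *\<^sub>R ((p / q) *\<^sub>R x\<^sub>0 + y\<^sub>0)"
    using \<open>q \<noteq> 0\<close> by (simp add: pq algebra_simps)
  then have "P = span {(p / q) *\<^sub>R x\<^sub>0 + y\<^sub>0}"
    using v(1) span_image_scale[of "{(p / q) *\<^sub>R x\<^sub>0 + y\<^sub>0}" "\<lambda>_. q"] \<open>q \<noteq> 0\<close> by simp
  moreover have "(p / q)\<^sup>2 = s"
    using e \<open>q \<noteq> 0\<close> by (simp add: power_divide)
  ultimately show "P \<in> {span {r *\<^sub>R x\<^sub>0 + y\<^sub>0} | r. r\<^sup>2 = s}" by blast
next
  fix P assume "P \<in> {span {r *\<^sub>R x\<^sub>0 + y\<^sub>0} | r. r\<^sup>2 = s}"
  then obtain r where r: "P = span {r *\<^sub>R x\<^sub>0 + y\<^sub>0}" "r\<^sup>2 = s" by blast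
  let ?v = "r *\<^sub>R x\<^sub>0 + y\<^sub>0"
  have v: "?v = r *\<^sub>R x\<^sub>0 + 1 *\<^sub>R y\<^sub>0" by simp
  have "?v \<noteq> 0" using lin_pairD[OF generator, of r 1] by auto
  moreover have "?v \<in> L" using in_span_pair[of r x\<^sub>0 1 y\<^sub>0] by simp
  ultimately show "P \<in> real_foci K L"
    using real_focus_iff[OF v] r unfolding real_foci_def by auto
qed

text \<open>The second point \<open>w\<close> of the line is chosen so that \<open>F(v + t w)\<close> becomes a monomial in \<open>t\<close>: the
other focus if there is one, and \<open>x\<^sub>0\<close> if \<open>s = 0\<close>.\<close>

lemma focus_multiplicity_eq:
  assumes r: "r\<^sup>2 = of_real s"
  shows "focus_multiplicity K L (vec.span {r *s cvec x\<^sub>0 + cvec y\<^sub>0}) (if s = 0 then 4 else 2)"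
proof -
  obtain B g C where B: "basis_of B (tangent_space K L)" and C: "basis_of C W" and g: "g \<noteq> 0" and
    F: "\<And>p q. focal_form B C (p *s cvec x\<^sub>0 + q *s cvec y\<^sub>0) = g * (p\<^sup>2 - of_real s * q\<^sup>2)\<^sup>2"
    by (rule focal_form_eq) blast
  let ?v = "r *s cvec x\<^sub>0 + cvec y\<^sub>0"
  have ind: "p = 0 \<and> q = 0" if "p *s cvec x\<^sub>0 + q *s cvec y\<^sub>0 = 0" for p q
    using cvec_pair_independent[OF generator that] .
  have v0: "?v \<noteq> 0" using ind[of r 1] by auto
  have v_mem: "?v \<in> cplx L" unfolding cplx_span_pair by (metis vector_smult_lid)
  have not_mem: "p *s cvec x\<^sub>0 + q *s cvec y\<^sub>0 \<notin> vec.span {?v}" if "p \<noteq> q * r" for p q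
  proof
    assume "p *s cvec x\<^sub>0 + q *s cvec y\<^sub>0 \<in> vec.span {?v}"
    then obtain k where "p *s cvec x\<^sub>0 + q *s cvec y\<^sub>0 = k *s ?v" by (auto simp: vec_span_singleton)
    then have "(p - k * r) *s cvec x\<^sub>0 + (q - k) *s cvec y\<^sub>0 = 0"
      by (simp add: vec_eq_iff algebra_simps)
    from ind[OF this] that show False by simp
  qed
  show ?thesis
  proof (cases "s = 0")
    case True
    with r have r0: "r = 0" by simp
    have "poly (monom g 4) t = focal_form B C (?v + t *s cvec x\<^sub>0)" for t
    proof -
      have "?v + t *s cvec x\<^sub>0 = t *s cvec x\<^sub>0 + 1 *s cvec y\<^sub>0" by (simp add: r0)
      then show ?thesis by (simp only: F) (simp add: True poly_monom power_mult[symmetric])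
    qed
    moreover have "cvec x\<^sub>0 \<notin> vec.span {?v}" using not_mem[of 1 0] by simp
    moreover have "cvec x\<^sub>0 \<in> cplx L"
      unfolding cplx_span_pair by (rule exI[of _ 1], rule exI[of _ 0]) simp
    ultimately show ?thesis
      unfolding focus_multiplicity_def using B C g v0 v_mem True
      by (intro exI[of _ B] exI[of _ C] exI[of _ ?v] exI[of _ "cvec x\<^sub>0"] exI[of _ "monom g 4"]) simp
  next
    case False
    with r have r0: "r \<noteq> 0" by auto
    let ?w = "(- r) *s cvec x\<^sub>0 + 1 *s cvec y\<^sub>0"
    let ?F = "monom (16 * (of_real s)\<^sup>2 * g) 2"
    have "poly ?F t = focal_form B C (?v + t *s ?w)" for t
    proof -
      have "?v + t *s ?w = (r * (1 - t)) *s cvec x\<^sub>0 + (1 + t) *s cvec y\<^sub>0"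
        by (simp add: vec_eq_iff algebra_simps)
      then have "focal_form B C (?v + t *s ?w) =
          g * (r\<^sup>2 * (1 - t)\<^sup>2 - of_real s * (1 + t)\<^sup>2)\<^sup>2"
        by (simp only: F power_mult_distrib)
      also have "\<dots> = 16 * (of_real s)\<^sup>2 * g * t\<^sup>2"
        unfolding r by (simp add: power2_eq_square algebra_simps)
      finally show ?thesis by (simp add: poly_monom)
    qed
    moreover have "?w \<notin> vec.span {?v}" using r0 by (intro not_mem) simp
    moreover have "?w \<in> cplx L" unfolding cplx_span_pair by blast
    ultimately show ?thesis
      unfolding focus_multiplicity_def using B C g v0 v_mem False
      by (intro exI[of _ B] exI[of _ C] exI[of _ ?v] exI[of _ ?w] exI[of _ ?F]) simp
  qed
qed

end

section \<open>Types of the congruences\<close>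

lemma conj_set_span: "conj_set (vec.span {v}) = vec.span {\<chi> i. cnj (v $ i)}"
proof -
  have c: "(\<chi> i. cnj ((c *s v) $ i)) = cnj c *s (\<chi> i. cnj (v $ i))" for c
    by (simp add: vec_eq_iff)
  show ?thesis
  proof (intro subset_antisym subsetI)
    fix u assume "u \<in> conj_set (vec.span {v})"
    then obtain k where "u = cnj k *s (\<chi> i. cnj (v $ i))"
      unfolding conj_set_def vec_span_singleton using c by blast
    then show "u \<in> vec.span {\<chi> i. cnj (v $ i)}"
      unfolding vec_span_singleton by blast
  next
    fix u assume "u \<in> vec.span {\<chi> i. cnj (v $ i)}"
    then obtain k where "u = k *s (\<chi> i. cnj (v $ i))"
      unfolding vec_span_singleton by blast
    then have "u = (\<chi> i. cnj ((cnj k *s v) $ i))" by (simp only: c complex_cnj_cnj)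
    then show "u \<in> conj_set (vec.span {v})"
      unfolding conj_set_def vec_span_singleton by blast
  qed
qed

lemma image_of_two_roots:
  assumes "\<And>r. P r \<longleftrightarrow> r = a \<or> r = b"
  shows "{f r | r. P r} = {f a, f b}"
  using assms by auto

lemma cplx_span_focus:
  "cplx (span {r *\<^sub>R x + y}) = vec.span {of_real r *s cvec x + cvec y}"
  by (simp add: cplx_span_singleton)

context quadratic_operator
begin

text \<open>The foci are eigenvectors of \<open>T\<close>, with eigenvalue \<open>r\<close>.\<close>

lemma cmat_T_focus:
  assumes "of_real s = r\<^sup>2"
  shows "cmat T *v (r *s cvec x + cvec (T *v x)) = r *s (r *s cvec x + cvec (T *v x))"
  by (simp add: matrix_vector_right_distrib vector_scalar_commute cmat_mult_cvec T_T assms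
      vector_add_ldistrib power2_eq_square add.commute)

text \<open>Here \<open>T\<^sup>2 = 0\<close>, and the focus of the line of \<open>x\<close> is \<open>T x\<close>.  These points fill the kernel of \<open>T\<close> if it is
equal to the image.\<close>

lemma parabolic_K:
  assumes s: "s = 0" and d: "dim {v. T *v v = 0} = 3" and ker: "\<And>v. T *v v = 0 \<Longrightarrow> \<exists>x. v = T *v x"
  shows "parabolic K"
proof -
  define \<pi> where "\<pi> = {v. T *v v = 0}"
  have sub: "subspace \<pi>"
    by (auto simp: \<pi>_def subspace_def T_simps)
  have foci: "real_foci K L = {span {T *v x}}"
    "complex_foci K L = {cplx (span {T *v x})}"
    "focus_multiplicity K L (cplx (span {T *v x})) 4"
    if x: "lin_pair x (T *v x)" and L: "L = span {x, T *v x}" for x L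
  proof -
    obtain \<alpha> \<beta> where "line_frame T s x \<alpha> \<beta>" using line_frame_at[OF x] .
    then interpret f: line_frame T s x \<alpha> \<beta> .
    show "real_foci K L = {span {T *v x}}" "complex_foci K L = {cplx (span {T *v x})}"
      unfolding L f.real_foci_eq f.complex_foci_eq
      using cplx_span_focus[of 0 x "T *v x"] by (simp_all add: s)
    show "focus_multiplicity K L (cplx (span {T *v x})) 4"
      using f.focus_multiplicity_eq[of 0] cplx_span_focus[of 0 x "T *v x"] by (simp add: L s)
  qed
  have foci_of_line: "\<exists>p. real_foci K L = {p} \<and> complex_foci K L = {cplx p} \<and> focus_multiplicity K L (cplx p) 4"
    if "L \<in> K" for L
  proof -
    obtain x where x: "lin_pair x (T *v x)" "L = span {x, T *v x}"
      using \<open>L \<in> K\<close> by (auto simp: K_def)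
    show ?thesis by (intro exI[of _ "span {T *v x}"] conjI foci[OF x])
  qed
  have union: "(\<Union>L\<in>K. real_foci K L) = real_points \<pi>"
  proof (intro subset_antisym subsetI)
    fix P assume "P \<in> (\<Union>L\<in>K. real_foci K L)"
    then obtain L x where x: "lin_pair x (T *v x)" and "L = span {x, T *v x}" "P \<in> real_foci K L"
      unfolding K_def by blast
    then have P: "P = span {T *v x}" using foci(1)[of x L] by simp
    have "T *v x \<in> \<pi>" "T *v x \<noteq> 0"
      using lin_pairD[OF x, of 0 1] by (auto simp: \<pi>_def T_simps s)
    then show "P \<in> real_points \<pi>" unfolding real_points_def P by blast
  next
    fix P assume "P \<in> real_points \<pi>"
    then obtain v where v: "P = span {v}" "T *v v = 0" "v \<noteq> 0" by (auto simp: real_points_def \<pi>_def)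
    obtain x where x: "v = T *v x" using ker[OF v(2)] by blast
    have l: "lin_pair x (T *v x)"
      unfolding lin_pair_def
    proof (intro allI impI)
      fix p q assume e: "p *\<^sub>R x + q *\<^sub>R (T *v x) = 0"
      have "T *v (p *\<^sub>R x + q *\<^sub>R (T *v x)) = p *\<^sub>R v" by (simp add: T_simps s x)
      then have "p = 0" using v(3) by (simp add: e)
      then show "p = 0 \<and> q = 0" using e v(3) by (simp add: x)
    qed
    then have "span {x, T *v x} \<in> K" unfolding K_def by blast
    moreover have "P \<in> real_foci K (span {x, T *v x})"
      unfolding foci(1)[OF l refl] using v(1) x by simp
    ultimately show "P \<in> (\<Union>L\<in>K. real_foci K L)" by (rule UN_I)
  qed
  show ?thesis
    unfolding parabolic_def
    by (rule conjI[OF congruence_K], rule exI[of _ \<pi>],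
        intro conjI ballI sub foci_of_line union d[folded \<pi>_def])
qed

text \<open>The line of \<open>x\<close> has the foci \<open>T x + x\<close> and \<open>T x - x\<close>, one in each eigenspace.  Conversely the line
joining eigenvectors \<open>a\<close>, \<open>b\<close> for \<open>1\<close>, \<open>-1\<close> is that of \<open>x = (a - b) / 2\<close>, with foci \<open>a\<close> and \<open>b\<close>.\<close>

lemma hyperbolic_K:
  assumes s: "s = 1"
    and d: "dim {v. T *v v = v} = 3" "dim {v. T *v v = - v} = 3"
  shows "hyperbolic K"
proof -
  define \<pi>\<^sub>1 where "\<pi>\<^sub>1 = {v. T *v v = v}"
  define \<pi>\<^sub>2 where "\<pi>\<^sub>2 = {v. T *v v = - v}"
  have sub: "subspace \<pi>\<^sub>1" "subspace \<pi>\<^sub>2"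
    by (auto simp: \<pi>\<^sub>1_def \<pi>\<^sub>2_def subspace_def T_simps)
  have "v = 0" if "T *v v = v" "T *v v = - v" for v
  proof -
    have "v + T *v v = 0" using that(2) by simp
    then have "2 *\<^sub>R v = 0" unfolding that(1) by (simp only: scaleR_2)
    then show ?thesis by simp
  qed
  then have int: "\<pi>\<^sub>1 \<inter> \<pi>\<^sub>2 = {0}"
    using sub by (auto simp: \<pi>\<^sub>1_def \<pi>\<^sub>2_def)
  have gen: "lin_pair ((1/2) *\<^sub>R (a - b)) (T *v ((1/2) *\<^sub>R (a - b)))"
    and Tgen: "T *v ((1/2) *\<^sub>R (a - b)) = (1/2) *\<^sub>R (a + b)"
    if a: "a \<in> \<pi>\<^sub>1" "a \<noteq> 0" and b: "b \<in> \<pi>\<^sub>2" "b \<noteq> 0" for a b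
  proof -
    show Tg: "T *v ((1/2) *\<^sub>R (a - b)) = (1/2) *\<^sub>R (a + b)"
      using a b by (simp add: T_simps \<pi>\<^sub>1_def \<pi>\<^sub>2_def)
    show "lin_pair ((1/2) *\<^sub>R (a - b)) (T *v ((1/2) *\<^sub>R (a - b)))"
      unfolding lin_pair_def
    proof (intro allI impI)
      fix p q assume "p *\<^sub>R ((1/2) *\<^sub>R (a - b)) + q *\<^sub>R (T *v ((1/2) *\<^sub>R (a - b))) = 0"
      then have e: "((p + q) / 2) *\<^sub>R a = ((p - q) / 2) *\<^sub>R b"
        unfolding Tg by (simp add: algebra_simps add_divide_distrib diff_divide_distrib)
      then have "((p + q) / 2) *\<^sub>R a \<in> \<pi>\<^sub>1 \<inter> \<pi>\<^sub>2"
        using a b sub subspace_scale by (metis IntI)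
      then have "((p + q) / 2) *\<^sub>R a = 0" using int by simp
      with e a(2) b(2) show "p = 0 \<and> q = 0" by auto
    qed
  qed
  have foci: "real_foci K L = {span {x + T *v x}, span {- x + T *v x}}"
    "complex_foci K L = {cplx (span {x + T *v x}), cplx (span {- x + T *v x})}"
    "focus_multiplicity K L (cplx (span {x + T *v x})) 2"
    "focus_multiplicity K L (cplx (span {- x + T *v x})) 2"
    if x: "lin_pair x (T *v x)" and L: "L = span {x, T *v x}" for x L
  proof -
    obtain \<alpha> \<beta> where "line_frame T s x \<alpha> \<beta>" using line_frame_at[OF x] .
    then interpret f: line_frame T s x \<alpha> \<beta> .
    have roots: "r\<^sup>2 = s \<longleftrightarrow> r = 1 \<or> r = -1" "z\<^sup>2 = of_real s \<longleftrightarrow> z = 1 \<or> z = -1"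
      for r and z :: complex
      by (simp_all add: s power2_eq_1_iff)
    show "real_foci K L = {span {x + T *v x}, span {- x + T *v x}}"
      "complex_foci K L = {cplx (span {x + T *v x}), cplx (span {- x + T *v x})}"
      unfolding L f.real_foci_eq f.complex_foci_eq image_of_two_roots[OF roots(1)] image_of_two_roots[OF roots(2)]
      using cplx_span_focus[of 1 x "T *v x"] cplx_span_focus[of "-1" x "T *v x"] by simp_all
    show "focus_multiplicity K L (cplx (span {x + T *v x})) 2"
      "focus_multiplicity K L (cplx (span {- x + T *v x})) 2"
      using f.focus_multiplicity_eq[of 1] f.focus_multiplicity_eq[of "-1"]
        cplx_span_focus[of 1 x "T *v x"] cplx_span_focus[of "-1" x "T *v x"]
      by (simp_all add: L s)
  qed
  have \<pi>_foci: "x + T *v x \<in> \<pi>\<^sub>1" "- x + T *v x \<in> \<pi>\<^sub>2" for x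
    by (simp_all add: \<pi>\<^sub>1_def \<pi>\<^sub>2_def T_simps s)
  have nz: "x + T *v x \<noteq> 0" "- x + T *v x \<noteq> 0" if "lin_pair x (T *v x)" for x
    using lin_pairD[OF that, of 1 1] lin_pairD[OF that, of "-1" 1] by auto
  have foci_of_line: "\<exists>p q. p \<noteq> q \<and> real_foci K L = {p, q} \<and> complex_foci K L = {cplx p, cplx q} \<and>
      focus_multiplicity K L (cplx p) 2 \<and> focus_multiplicity K L (cplx q) 2 \<and>
      p \<subseteq> \<pi>\<^sub>1 \<and> q \<subseteq> \<pi>\<^sub>2" if "L \<in> K" for L
  proof -
    obtain x where x: "lin_pair x (T *v x)" "L = span {x, T *v x}"
      using \<open>L \<in> K\<close> by (auto simp: K_def)
    have p: "span {x + T *v x} \<subseteq> \<pi>\<^sub>1" "span {- x + T *v x} \<subseteq> \<pi>\<^sub>2"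
      using \<pi>_foci[of x] sub by (simp_all add: span_minimal)
    have "span {x + T *v x} \<noteq> span {- x + T *v x}"
    proof
      assume e: "span {x + T *v x} = span {- x + T *v x}"
      have "x + T *v x \<in> span {x + T *v x}" by (simp add: span_base)
      then have "x + T *v x \<in> \<pi>\<^sub>1 \<inter> \<pi>\<^sub>2" using e p by blast
      then show False using int nz(1)[OF x(1)] by simp
    qed
    with p foci[OF x] show ?thesis
      by (intro exI[of _ "span {x + T *v x}"] exI[of _ "span {- x + T *v x}"]) simp
  qed
  have union: "(\<Union>L\<in>K. real_foci K L) = real_points \<pi>\<^sub>1 \<union> real_points \<pi>\<^sub>2"
  proof (intro subset_antisym subsetI)
    fix P assume "P \<in> (\<Union>L\<in>K. real_foci K L)"
    then obtain L x where x: "lin_pair x (T *v x)" and "L = span {x, T *v x}" "P \<in> real_foci K L"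
      unfolding K_def by blast
    then have "P = span {x + T *v x} \<or> P = span {- x + T *v x}" using foci(1)[of x L] by simp
    then show "P \<in> real_points \<pi>\<^sub>1 \<union> real_points \<pi>\<^sub>2"
      using \<pi>_foci[of x] nz[OF x] unfolding real_points_def by blast
  next
    have ne: "\<exists>a\<in>\<pi>\<^sub>1. a \<noteq> 0" "\<exists>b\<in>\<pi>\<^sub>2. b \<noteq> 0"
      using d unfolding \<pi>\<^sub>1_def[symmetric] \<pi>\<^sub>2_def[symmetric]
      using exists_outside_span[of "{}" \<pi>\<^sub>1] exists_outside_span[of "{}" \<pi>\<^sub>2] by auto
    fix P assume "P \<in> real_points \<pi>\<^sub>1 \<union> real_points \<pi>\<^sub>2"
    then obtain a b where ab: "a \<in> \<pi>\<^sub>1" "a \<noteq> 0" "b \<in> \<pi>\<^sub>2" "b \<noteq> 0" "P = span {a} \<or> P = span {b}"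
      using ne unfolding real_points_def by blast
    let ?x = "(1/2) *\<^sub>R (a - b)"
    have "?x + T *v ?x = a" "- ?x + T *v ?x = b"
      unfolding Tgen[OF ab(1-4)] by (simp_all add: algebra_simps flip: scaleR_add_left)
    then have "P \<in> real_foci K (span {?x, T *v ?x})"
      unfolding foci(1)[OF gen[OF ab(1-4)] refl] using ab(5) by simp
    moreover have "span {?x, T *v ?x} \<in> K"
      using gen[OF ab(1-4)] unfolding K_def by blast
    ultimately show "P \<in> (\<Union>L\<in>K. real_foci K L)" by (rule UN_I[rotated])
  qed
  have K_eq: "K = {L \<in> lines. L \<inter> \<pi>\<^sub>1 \<noteq> {0} \<and> L \<inter> \<pi>\<^sub>2 \<noteq> {0}}"
  proof (intro subset_antisym subsetI)
    fix L assume "L \<in> K"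
    then obtain x where x: "lin_pair x (T *v x)" "L = span {x, T *v x}" by (auto simp: K_def)
    have "x + T *v x \<in> L" "- x + T *v x \<in> L"
      using in_span_pair[of 1 x 1 "T *v x"] in_span_pair[of "-1" x 1 "T *v x"] by (simp_all add: x(2))
    then show "L \<in> {L \<in> lines. L \<inter> \<pi>\<^sub>1 \<noteq> {0} \<and> L \<inter> \<pi>\<^sub>2 \<noteq> {0}}"
      using \<pi>_foci[of x] nz[OF x(1)] \<open>L \<in> K\<close> K_subset_lines by blast
  next
    fix L assume L: "L \<in> {L \<in> lines. L \<inter> \<pi>\<^sub>1 \<noteq> {0} \<and> L \<inter> \<pi>\<^sub>2 \<noteq> {0}}"
    then have l: "subspace L" "dim L = 2" by (auto simp: lines_def)
    have "0 \<in> L \<inter> \<pi>\<^sub>1" "0 \<in> L \<inter> \<pi>\<^sub>2" using l(1) sub by (simp_all add: subspace_0)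
    then obtain a b where ab: "a \<in> \<pi>\<^sub>1" "a \<noteq> 0" "b \<in> \<pi>\<^sub>2" "b \<noteq> 0" and m: "a \<in> L" "b \<in> L"
      using L by blast
    let ?x = "(1/2) *\<^sub>R (a - b)"
    have "?x \<in> L" "T *v ?x \<in> L"
      unfolding Tgen[OF ab] using m l(1) subspace_scale subspace_diff subspace_add by blast+
    then have "span {?x, T *v ?x} = L"
      using l gen[OF ab] by (intro span_pair_eq_subspace)
    then show "L \<in> K" using gen[OF ab] unfolding K_def by blast
  qed
  show ?thesis
    unfolding hyperbolic_def
    by (rule conjI[OF congruence_K], rule exI[of _ \<pi>\<^sub>1], rule exI[of _ \<pi>\<^sub>2],
        intro conjI ballI sub int foci_of_line union K_eq d[folded \<pi>\<^sub>1_def \<pi>\<^sub>2_def])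
qed

text \<open>The foci of the line of \<open>x\<close> are \<open>T x + i x\<close> and \<open>T x - i x\<close>, one in each of the conjugate eigenspaces.
Conversely an eigenvector for \<open>i e\<close>, where \<open>e\<close> is \<open>1\<close> or \<open>-1\<close>, has this form, with \<open>x\<close> equal to \<open>e\<close>
times its imaginary part.\<close>

lemma elliptic_K:
  assumes s: "s = -1" and d: "vec.dim {v. cmat T *v v = \<i> *s v} = 3"
  shows "elliptic K"
proof -
  define \<pi> where "\<pi> e = {v. cmat T *v v = (\<i> * of_real e) *s v}" for e :: real
  have sub: "vec.subspace (\<pi> e)" for e
    by (auto simp: \<pi>_def vec.subspace_def matrix_vector_right_distrib vector_scalar_commute
        vector_add_ldistrib mult.commute)
  have int: "\<pi> 1 \<inter> \<pi> (-1) = {0}"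
    by (auto simp: \<pi>_def vec_eq_iff)
  have \<pi>_iff: "v \<in> \<pi> e \<longleftrightarrow> T *v (\<chi> i. Re (v $ i)) = (- e) *\<^sub>R (\<chi> i. Im (v $ i)) \<and>
      T *v (\<chi> i. Im (v $ i)) = e *\<^sub>R (\<chi> i. Re (v $ i))" for v e
    by (auto simp: \<pi>_def vec_eq_iff complex_eq_iff matrix_vector_mult_def)
  have conj: "conj_set (\<pi> 1) = \<pi> (-1)"
  proof -
    have c: "(\<chi> i. cnj (v $ i)) \<in> \<pi> e" if "v \<in> \<pi> (- e)" for v e
      using that by (simp add: \<pi>_def vec_eq_iff matrix_vector_mult_def complex_eq_iff sum_negf)
    have "(\<chi> i. cnj ((\<chi> i. cnj (v $ i)) $ i)) = v" for v :: C6
      by (simp add: vec_eq_iff)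
    then show ?thesis
      unfolding conj_set_def using c[of _ 1] c[of _ "-1"]
      by (intro subset_antisym subsetI) (auto intro!: image_eqI[of _ _ "\<chi> i. cnj (_ $ i)"])
  qed
  define P where "P e x = vec.span {(\<i> * of_real e) *s cvec x + cvec (T *v x)}" for e x
  have foci: "real_foci K L = {}" "complex_foci K L = {P 1 x, P (-1) x}"
    "focus_multiplicity K L (P 1 x) 2" "focus_multiplicity K L (P (-1) x) 2"
    if x: "lin_pair x (T *v x)" and L: "L = span {x, T *v x}" for x L
  proof -
    obtain \<alpha> \<beta> where "line_frame T s x \<alpha> \<beta>" using line_frame_at[OF x] .
    then interpret f: line_frame T s x \<alpha> \<beta> .
    have "r\<^sup>2 \<noteq> s" for r :: real
      using zero_le_power2[of r] unfolding s by linarith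
    then show "real_foci K L = {}" unfolding L f.real_foci_eq by simp
    have roots: "r\<^sup>2 = of_real s \<longleftrightarrow> r = \<i> * of_real 1 \<or> r = \<i> * of_real (-1)" for r
    proof -
      have "r\<^sup>2 - of_real s = (r - \<i> * of_real 1) * (r - \<i> * of_real (-1))"
        by (simp add: s algebra_simps power2_eq_square)
      then show ?thesis by (metis eq_iff_diff_eq_0 mult_eq_0_iff)
    qed
    show "complex_foci K L = {P 1 x, P (-1) x}"
      unfolding L f.complex_foci_eq image_of_two_roots[OF roots] P_def ..
    show "focus_multiplicity K L (P 1 x) 2" "focus_multiplicity K L (P (-1) x) 2"
      unfolding L P_def
      using f.focus_multiplicity_eq[of "\<i> * of_real 1"] f.focus_multiplicity_eq[of "\<i> * of_real (-1)"]
      by (simp_all add: s)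
  qed
  have \<pi>_foci: "(\<i> * of_real e) *s cvec x + cvec (T *v x) \<in> \<pi> e" if "e = 1 \<or> e = -1" for e x
    using that cmat_T_focus[of "\<i> * of_real e" x] by (auto simp: \<pi>_def s)
  have nz: "(\<i> * of_real e) *s cvec x + cvec (T *v x) \<noteq> 0" if "lin_pair x (T *v x)" for e x
    using cvec_pair_independent[OF that, of "\<i> * of_real e" 1] by auto
  have foci_of_line: "\<exists>p q. p \<noteq> q \<and> q = conj_set p \<and> real_foci K L = {} \<and> complex_foci K L = {p, q} \<and>
      focus_multiplicity K L p 2 \<and> focus_multiplicity K L q 2 \<and>
      p \<subseteq> \<pi> 1 \<and> q \<subseteq> \<pi> (-1)" if "L \<in> K" for L
  proof -
    obtain x where x: "lin_pair x (T *v x)" "L = span {x, T *v x}"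
      using \<open>L \<in> K\<close> by (auto simp: K_def)
    have p: "P 1 x \<subseteq> \<pi> 1" "P (-1) x \<subseteq> \<pi> (-1)"
      unfolding P_def using \<pi>_foci[of 1 x] \<pi>_foci[of "-1" x] sub by (simp_all add: vec.span_minimal)
    have "P 1 x \<noteq> P (-1) x"
    proof
      assume e: "P 1 x = P (-1) x"
      have "(\<i> * of_real 1) *s cvec x + cvec (T *v x) \<in> P 1 x" unfolding P_def by (rule vec.span_base) simp
      then have "(\<i> * of_real 1) *s cvec x + cvec (T *v x) \<in> \<pi> 1 \<inter> \<pi> (-1)" using e p by blast
      then show False using int nz[OF x(1), of 1] by simp
    qed
    moreover have "P (-1) x = conj_set (P 1 x)"
    proof -
      have "(\<chi> i. cnj (((\<i> * of_real 1) *s cvec x + cvec (T *v x)) $ i)) =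
          (\<i> * of_real (-1)) *s cvec x + cvec (T *v x)"
        by (simp add: vec_eq_iff)
      then show ?thesis unfolding P_def conj_set_span by simp
    qed
    ultimately show ?thesis using p foci[OF x]
      by (intro exI[of _ "P 1 x"] exI[of _ "P (-1) x"]) simp
  qed
  have union: "(\<Union>L\<in>K. complex_foci K L) = complex_points (\<pi> 1) \<union> complex_points (\<pi> (-1))"
  proof (intro subset_antisym subsetI)
    fix Q assume "Q \<in> (\<Union>L\<in>K. complex_foci K L)"
    then obtain L x where x: "lin_pair x (T *v x)" and "L = span {x, T *v x}" "Q \<in> complex_foci K L"
      unfolding K_def by blast
    then have "Q = P 1 x \<or> Q = P (-1) x" using foci(2)[of x L] by simp
    then show "Q \<in> complex_points (\<pi> 1) \<union> complex_points (\<pi> (-1))"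
      using \<pi>_foci[of 1 x] \<pi>_foci[of "-1" x] nz[OF x, of 1] nz[OF x, of "-1"]
      unfolding complex_points_def P_def by blast
  next
    fix Q assume "Q \<in> complex_points (\<pi> 1) \<union> complex_points (\<pi> (-1))"
    then obtain e v where e: "e = 1 \<or> e = -1" and v: "v \<in> \<pi> e" "v \<noteq> 0" "Q = vec.span {v}"
      unfolding complex_points_def by blast
    define x where "x = e *\<^sub>R (\<chi> i. Im (v $ i))"
    have Tx: "T *v x = (\<chi> i. Re (v $ i))"
    proof -
      have "T *v x = e *\<^sub>R (e *\<^sub>R (\<chi> i. Re (v $ i)))"
        unfolding x_def matrix_vector_mult_scaleR using v(1) unfolding \<pi>_iff by simp
      then show ?thesis using e by auto
    qed
    have v_eq: "(\<i> * of_real e) *s cvec x + cvec (T *v x) = v"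
      unfolding Tx unfolding x_def using e by (auto simp: vec_eq_iff complex_eq_iff)
    have "x \<noteq> 0" using v_eq v(2) by auto
    have l: "lin_pair x (T *v x)"
      unfolding lin_pair_def
    proof (intro allI impI)
      fix p q assume z: "p *\<^sub>R x + q *\<^sub>R (T *v x) = 0"
      have "(p\<^sup>2 + q\<^sup>2) *\<^sub>R x = p *\<^sub>R (p *\<^sub>R x + q *\<^sub>R (T *v x)) - q *\<^sub>R (T *v (p *\<^sub>R x + q *\<^sub>R (T *v x)))"
        by (simp add: T_simps s power2_eq_square algebra_simps)
      then have "(p\<^sup>2 + q\<^sup>2) *\<^sub>R x = 0" by (simp add: z)
      then show "p = 0 \<and> q = 0" using \<open>x \<noteq> 0\<close> by (simp add: sum_power2_eq_zero_iff)
    qed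
    have "Q = P e x" unfolding P_def v_eq by (rule v(3))
    then have "Q \<in> complex_foci K (span {x, T *v x})"
      unfolding foci(2)[OF l refl] using e by auto
    moreover have "span {x, T *v x} \<in> K" using l unfolding K_def by blast
    ultimately show "Q \<in> (\<Union>L\<in>K. complex_foci K L)" by (rule UN_I[rotated])
  qed
  have dim: "vec.dim (\<pi> 1) = 3" using d by (simp add: \<pi>_def)
  show ?thesis
    unfolding elliptic_def
    by (rule conjI[OF congruence_K], rule exI[of _ "\<pi> 1"], rule exI[of _ "\<pi> (-1)"],
        intro conjI ballI sub int dim conj[symmetric] foci_of_line union)
qed

end

section \<open>Freeness of the quotients\<close>

text \<open>The \<open>\<real>[T]\<close>-module is the sum of its two eigenspaces, and the line of \<open>x\<close> meets each of them in at
most one dimension; \<open>u\<close> and \<open>v\<close> are sums of eigenvectors that are independent modulo the line in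
both summands.\<close>

lemma free_quotient_involution:
  fixes T :: "real^'n^'n"
  assumes T: "\<And>x. T *v (T *v x) = x"
    and d: "dim {v. T *v v = v} = 3" "dim {v. T *v v = - v} = 3"
  shows "free_quotient T x"
proof -
  let ?a = "x + T *v x" and ?b = "x - T *v x"
  obtain a\<^sub>1 a\<^sub>2 where a: "T *v a\<^sub>1 = a\<^sub>1" "T *v a\<^sub>2 = a\<^sub>2"
    "\<And>c d. c *\<^sub>R a\<^sub>1 + d *\<^sub>R a\<^sub>2 \<in> span {?a} \<Longrightarrow> c = 0 \<and> d = 0"
    using exists_two_mod_line[of "{v. T *v v = v}" ?a] d by auto
  obtain b\<^sub>1 b\<^sub>2 where b: "T *v b\<^sub>1 = - b\<^sub>1" "T *v b\<^sub>2 = - b\<^sub>2"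
    "\<And>c d. c *\<^sub>R b\<^sub>1 + d *\<^sub>R b\<^sub>2 \<in> span {?b} \<Longrightarrow> c = 0 \<and> d = 0"
    using exists_two_mod_line[of "{v. T *v v = - v}" ?b] d by auto
  have "c\<^sub>1 = 0 \<and> c\<^sub>2 = 0 \<and> d\<^sub>1 = 0 \<and> d\<^sub>2 = 0"
    if m: "c\<^sub>1 *\<^sub>R (a\<^sub>1 + b\<^sub>1) + c\<^sub>2 *\<^sub>R (T *v (a\<^sub>1 + b\<^sub>1)) + d\<^sub>1 *\<^sub>R (a\<^sub>2 + b\<^sub>2) + d\<^sub>2 *\<^sub>R (T *v (a\<^sub>2 + b\<^sub>2))
      \<in> span {x, T *v x}" (is "?z \<in> _") for c\<^sub>1 c\<^sub>2 d\<^sub>1 d\<^sub>2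
  proof -
    obtain p q where z: "?z = p *\<^sub>R x + q *\<^sub>R (T *v x)" using m by (rule in_span_pairE)
    have "?z + T *v ?z = (2 * (c\<^sub>1 + c\<^sub>2)) *\<^sub>R a\<^sub>1 + (2 * (d\<^sub>1 + d\<^sub>2)) *\<^sub>R a\<^sub>2"
      "?z - T *v ?z = (2 * (c\<^sub>1 - c\<^sub>2)) *\<^sub>R b\<^sub>1 + (2 * (d\<^sub>1 - d\<^sub>2)) *\<^sub>R b\<^sub>2"
      by (simp_all add: matrix_vector_right_distrib matrix_vector_mult_scaleR T a(1,2) b(1,2) algebra_simps
          scaleR_2 flip: scaleR_scaleR)
    moreover have "?z + T *v ?z = (p + q) *\<^sub>R ?a" "?z - T *v ?z = (p - q) *\<^sub>R ?b"
      unfolding z by (simp_all add: matrix_vector_right_distrib matrix_vector_mult_scaleR T algebra_simps)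
    ultimately have "(2 * (c\<^sub>1 + c\<^sub>2)) *\<^sub>R a\<^sub>1 + (2 * (d\<^sub>1 + d\<^sub>2)) *\<^sub>R a\<^sub>2 \<in> span {?a}"
      "(2 * (c\<^sub>1 - c\<^sub>2)) *\<^sub>R b\<^sub>1 + (2 * (d\<^sub>1 - d\<^sub>2)) *\<^sub>R b\<^sub>2 \<in> span {?b}"
      by (metis singletonI span_base span_scale)+
    from a(3)[OF this(1)] b(3)[OF this(2)] show ?thesis by auto
  qed
  then show ?thesis unfolding free_quotient_def by (intro exI allI impI)
qed

text \<open>Over \<open>\<real>[T]\<close> with \<open>T\<^sup>2 = 0\<close>, vectors are free generators as soon as their images under \<open>T\<close> are linearly
independent: applying \<open>T\<close> to a relation kills the coefficients of the vectors themselves, and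
what remains is a relation between the images.\<close>

lemma free_quotient_nilpotent:
  fixes T :: "real^'n^'n"
  assumes T: "\<And>x. T *v (T *v x) = 0" and x: "T *v x \<noteq> 0" and d: "dim (range ((*v) T)) = 3"
  shows "free_quotient T x"
proof -
  obtain a b where ab: "a \<in> range ((*v) T)" "b \<in> range ((*v) T)"
    "\<And>c d. c *\<^sub>R a + d *\<^sub>R b \<in> span {T *v x} \<Longrightarrow> c = 0 \<and> d = 0"
    using exists_two_mod_line[of "range ((*v) T)" "T *v x"] d by auto
  obtain u v where uv: "a = T *v u" "b = T *v v" using ab(1,2) by auto
  have "c\<^sub>1 = 0 \<and> c\<^sub>2 = 0 \<and> d\<^sub>1 = 0 \<and> d\<^sub>2 = 0"
    if m: "c\<^sub>1 *\<^sub>R u + c\<^sub>2 *\<^sub>R (T *v u) + d\<^sub>1 *\<^sub>R v + d\<^sub>2 *\<^sub>R (T *v v) \<in> span {x, T *v x}"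
    (is "?z \<in> _") for c\<^sub>1 c\<^sub>2 d\<^sub>1 d\<^sub>2
  proof -
    obtain p q where z: "?z = p *\<^sub>R x + q *\<^sub>R (T *v x)" using m by (rule in_span_pairE)
    have "T *v ?z = c\<^sub>1 *\<^sub>R a + d\<^sub>1 *\<^sub>R b"
      by (simp add: matrix_vector_right_distrib matrix_vector_mult_scaleR T uv)
    moreover have "T *v ?z = p *\<^sub>R (T *v x)"
      unfolding z by (simp add: matrix_vector_right_distrib matrix_vector_mult_scaleR T)
    ultimately have Tz: "c\<^sub>1 *\<^sub>R a + d\<^sub>1 *\<^sub>R b = p *\<^sub>R (T *v x)" by simp
    then have cd: "c\<^sub>1 = 0 \<and> d\<^sub>1 = 0"
      by (intro ab(3)) (metis singletonI span_base span_scale)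
    then have "p *\<^sub>R (T *v x) = 0" using Tz by simp
    then have "p = 0" using x by simp
    then have "c\<^sub>2 *\<^sub>R a + d\<^sub>2 *\<^sub>R b = q *\<^sub>R (T *v x)" using z cd by (simp add: uv)
    then have "c\<^sub>2 = 0 \<and> d\<^sub>2 = 0"
      by (intro ab(3)) (metis singletonI span_base span_scale)
    with cd show ?thesis by simp
  qed
  then show ?thesis unfolding free_quotient_def by blast
qed

text \<open>Here \<open>\<real>[T]\<close> is the field of complex numbers, so a vector outside an invariant subspace
always generates a free module modulo this subspace: in \<open>step\<close> a relation is multiplied by the
conjugate \<open>c - d T\<close> of its coefficient.\<close>

lemma free_quotient_imaginary:
  fixes T :: "real^'n^'n"
  assumes T: "\<And>x. T *v (T *v x) = - x" and d: "4 < CARD('n)"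
  shows "free_quotient T x"
proof -
  have step: "c = 0 \<and> d = 0"
    if S: "subspace S" "\<And>z. z \<in> S \<Longrightarrow> T *v z \<in> S" "v \<notin> S"
      and m: "c *\<^sub>R v + d *\<^sub>R (T *v v) \<in> S" for S v c d
  proof -
    have "c *\<^sub>R (c *\<^sub>R v + d *\<^sub>R (T *v v)) - d *\<^sub>R (T *v (c *\<^sub>R v + d *\<^sub>R (T *v v))) \<in> S"
      using S m by (intro subspace_diff subspace_scale) auto
    also have "c *\<^sub>R (c *\<^sub>R v + d *\<^sub>R (T *v v)) - d *\<^sub>R (T *v (c *\<^sub>R v + d *\<^sub>R (T *v v))) =
        (c\<^sup>2 + d\<^sup>2) *\<^sub>R v"
      by (simp add: matrix_vector_right_distrib matrix_vector_mult_scaleR T power2_eq_square algebra_simps)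
    finally have "c\<^sup>2 + d\<^sup>2 = 0" using scaleR_memD[OF S(1)] S(3) by blast
    then show ?thesis by (simp add: sum_power2_eq_zero_iff)
  qed
  have inv: "T *v z \<in> span A" if A: "\<And>w. w \<in> A \<Longrightarrow> T *v w \<in> span A" and z: "z \<in> span A" for z A
  proof -
    have "span A \<subseteq> {z. T *v z \<in> span A}"
      by (rule span_minimal) (auto simp: A subspace_def matrix_vector_right_distrib
          matrix_vector_mult_scaleR span_zero intro: span_add span_scale)
    with z show ?thesis by blast
  qed
  let ?L = "span {x, T *v x}"
  have "card {x, T *v x} \<le> 2" by (simp add: card_insert_if)
  then obtain u where u: "u \<notin> ?L"
    using exists_outside_span[of "{x, T *v x}" UNIV] d by auto
  let ?S = "span {x, T *v x, u, T *v u}"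
  have "card {x, T *v x, u, T *v u} \<le> 4" by (simp add: card_insert_if)
  then obtain v where v: "v \<notin> ?S"
    using exists_outside_span[of "{x, T *v x, u, T *v u}" UNIV] d by auto
  have L_inv: "T *v z \<in> ?L" if "z \<in> ?L" for z
    using that by (rule inv[rotated]) (auto simp: T span_base span_neg)
  have S_inv: "T *v z \<in> ?S" if "z \<in> ?S" for z
    using that by (rule inv[rotated]) (auto simp: T span_base span_neg)
  have LS: "?L \<subseteq> ?S" by (rule span_mono) auto
  have "c\<^sub>1 = 0 \<and> c\<^sub>2 = 0 \<and> d\<^sub>1 = 0 \<and> d\<^sub>2 = 0"
    if m: "c\<^sub>1 *\<^sub>R u + c\<^sub>2 *\<^sub>R (T *v u) + d\<^sub>1 *\<^sub>R v + d\<^sub>2 *\<^sub>R (T *v v) \<in> ?L" for c\<^sub>1 c\<^sub>2 d\<^sub>1 d\<^sub>2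
  proof -
    have "c\<^sub>1 *\<^sub>R u + c\<^sub>2 *\<^sub>R (T *v u) \<in> ?S"
      by (intro span_add span_scale) (auto intro: span_base)
    then have "(c\<^sub>1 *\<^sub>R u + c\<^sub>2 *\<^sub>R (T *v u) + d\<^sub>1 *\<^sub>R v + d\<^sub>2 *\<^sub>R (T *v v)) - (c\<^sub>1 *\<^sub>R u + c\<^sub>2 *\<^sub>R (T *v u)) \<in> ?S"
      using m LS by (intro span_diff) auto
    then have "d\<^sub>1 *\<^sub>R v + d\<^sub>2 *\<^sub>R (T *v v) \<in> ?S" by (simp add: algebra_simps)
    from step[OF subspace_span S_inv v this] have "d\<^sub>1 = 0 \<and> d\<^sub>2 = 0" by simp
    moreover from this m have "c\<^sub>1 *\<^sub>R u + c\<^sub>2 *\<^sub>R (T *v u) \<in> ?L" by simp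
    from step[OF subspace_span L_inv u this] have "c\<^sub>1 = 0 \<and> c\<^sub>2 = 0" by simp
    ultimately show ?thesis by simp
  qed
  then show ?thesis unfolding free_quotient_def by blast
qed

section \<open>The three algebras\<close>

text \<open>The block diagonal matrix with three blocks \<open>G\<close>.\<close>

definition block_op :: "real^2^2 \<Rightarrow> real^(3 \<times> 2)^(3 \<times> 2)" where
  "block_op G = (\<chi> r c. if fst r = fst c then G $ snd r $ snd c else 0)"

lemma block_sum:
  fixes x :: "'a::field^(3 \<times> 2)"
  shows "(\<Sum>c\<in>UNIV. (if k = fst c then g (snd c) else 0) * x $ c) = g 1 * x $ (k, 1) + g 2 * x $ (k, 2)"
proof -
  have "(\<Sum>c\<in>UNIV. (if k = fst c then g (snd c) else 0) * x $ c) =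
      (\<Sum>l\<in>UNIV. \<Sum>j\<in>UNIV. (if k = l then g j else 0) * x $ (l, j))"
    by (simp add: sum.cartesian_product case_prod_beta)
  also have "\<dots> = (\<Sum>l\<in>UNIV. if k = l then g 1 * x $ (l, 1) + g 2 * x $ (l, 2) else 0)"
    by (intro sum.cong refl) (simp add: sum_2)
  finally show ?thesis by simp
qed

lemma block_op_apply:
  "(block_op G *v x) $ (k, i) = G $ i $ 1 * x $ (k, 1) + G $ i $ 2 * x $ (k, 2)"
  using block_sum[of k "\<lambda>j. G $ i $ j" x] by (simp add: matrix_vector_mult_def block_op_def cong: if_cong)

lemma cmat_block_op_apply:
  "(cmat (block_op G) *v x) $ (k, i) =
    of_real (G $ i $ 1) * x $ (k, 1) + of_real (G $ i $ 2) * x $ (k, 2)"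
proof -
  have "(cmat (block_op G) *v x) $ (k, i) =
      (\<Sum>c\<in>UNIV. (if k = fst c then of_real (G $ i $ snd c) else 0) * x $ c)"
    unfolding matrix_vector_mult_def by (simp add: block_op_def if_distrib cong: if_cong)
  then show ?thesis using block_sum[of k "\<lambda>j. of_real (G $ i $ j)" x] by simp
qed

lemma vec_3_2_eq_iff:
  fixes x :: "'a^(3 \<times> 2)"
  shows "x = y \<longleftrightarrow> (\<forall>k. x $ (k, 1) = y $ (k, 1) \<and> x $ (k, 2) = y $ (k, 2))"
  by (simp only: vec_eq_iff split_paired_All forall_2)

text \<open>All eigenspaces that occur have this form: the two coordinates of each block are fixed multiples
of one parameter.\<close>

lemma dim_graph:
  fixes g :: "2 \<Rightarrow> 'a::field"
  assumes "g i \<noteq> 0"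
  shows "vec.dim (range (\<lambda>y :: 'a^3. (\<chi> r. g (snd r) * y $ fst r) :: 'a^(3 \<times> 2))) = 3"
proof -
  let ?f = "\<lambda>y :: 'a^3. (\<chi> r. g (snd r) * y $ fst r) :: 'a^(3 \<times> 2)"
  have "Vector_Spaces.linear (*s) (*s) ?f"
    by unfold_locales (simp_all add: vec_eq_iff algebra_simps)
  moreover have "inj ?f"
  proof (rule injI)
    fix y z assume "?f y = ?f z"
    then have "?f y $ (k, i) = ?f z $ (k, i)" for k by simp
    then show "y = z" using assms by (simp add: vec_eq_iff)
  qed
  ultimately have "vec.dim (range ?f) = vec.dim (UNIV :: ('a^3) set)"
    by (intro vec.dim_image_eq) (auto simp: inj_on_def)
  then show ?thesis unfolding vec_dim_card by simp
qed

lemma column_1_point_mat: "column 1 (point_mat \<rho> X) $ (k, i) = \<rho> (X $ k) $ i $ 1"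
  and column_2_point_mat: "column 2 (point_mat \<rho> X) $ (k, i) = \<rho> (X $ k) $ i $ 2"
  by (simp_all add: column_def point_mat_def)

text \<open>Applied with the conjugate \<open>P'\<close> of \<open>P\<close> and the norm \<open>n\<close>, which is a real number and hence zero or
a unit.\<close>

lemma nonzero_divisor_iff_unit:
  fixes P P' :: "'a::comm_ring_1"
  assumes "P * P' = n" "n \<noteq> 0 \<Longrightarrow> \<exists>u. u * n = 1" "P \<noteq> 0 \<Longrightarrow> P' \<noteq> 0"
  shows "nonzero_divisor P \<longleftrightarrow> n \<noteq> 0"
proof
  assume P: "nonzero_divisor P"
  show "n \<noteq> 0"
  proof
    assume "n = 0"
    then have "P' = 0" using P assms(1) by (simp add: nonzero_divisor_def mult.commute)
    then have "P = 0" using assms(3) by blast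
    then show False using P unfolding nonzero_divisor_def by (auto dest: spec[of _ 1])
  qed
next
  assume "n \<noteq> 0"
  then obtain u where u: "u * n = 1" using assms(2) by blast
  show "nonzero_divisor P"
    unfolding nonzero_divisor_def
  proof (intro allI impI)
    fix Q assume "Q * P = 0"
    have "Q = Q * (P * P') * u" using u by (simp add: assms(1) mult.commute mult.left_commute)
    also have "\<dots> = (Q * P) * P' * u" by (simp only: mult.assoc)
    finally show "Q = 0" by (simp add: \<open>Q * P = 0\<close>)
  qed
qed

subsection \<open>Complex numbers\<close>

lemma complex_mat_nth:
  "complex_mat z $ 1 $ 1 = Re z" "complex_mat z $ 1 $ 2 = - Im z"
  "complex_mat z $ 2 $ 1 = Im z" "complex_mat z $ 2 $ 2 = Re z"
  by (simp_all add: complex_mat_def)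

abbreviation complex_op where "complex_op \<equiv> block_op (complex_mat \<i>)"

lemma complex_op_apply:
  "(complex_op *v x) $ (k, 1) = - x $ (k, 2)" "(complex_op *v x) $ (k, 2) = x $ (k, 1)"
  by (simp_all add: block_op_apply complex_mat_nth)

lemma complex_op_square: "complex_op *v (complex_op *v x) = - x"
  by (simp add: vec_3_2_eq_iff complex_op_apply)

interpretation complex: algebra_representation complex_op "-1" complex_mat Complex
proof
  fix X Y :: "complex^3" and x :: R6 and p q :: real and P
  show "complex_op *v (complex_op *v x) = (-1) *\<^sub>R x" by (simp add: complex_op_square)
  show "free_quotient complex_op x"
    by (rule free_quotient_imaginary[OF complex_op_square]) simp
  show "column 2 (point_mat complex_mat X) = complex_op *v column 1 (point_mat complex_mat X)"
    by (simp add: vec_3_2_eq_iff complex_op_apply column_1_point_mat column_2_point_mat complex_mat_nth)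
  show "\<exists>X. column 1 (point_mat complex_mat X) = x"
    by (rule exI[of _ "\<chi> k. Complex (x $ (k, 1)) (x $ (k, 2))"])
      (simp add: vec_3_2_eq_iff column_1_point_mat complex_mat_nth)
  show "X = Y" if "column 1 (point_mat complex_mat X) = column 1 (point_mat complex_mat Y)"
    using that by (simp add: vec_3_2_eq_iff column_1_point_mat complex_mat_nth vec_eq_iff complex_eq_iff)
  show "column 1 (point_mat complex_mat (\<chi> k. X $ k * Complex p q)) =
      p *\<^sub>R column 1 (point_mat complex_mat X) + q *\<^sub>R (complex_op *v column 1 (point_mat complex_mat X))"
    by (simp add: vec_3_2_eq_iff complex_op_apply column_1_point_mat complex_mat_nth algebra_simps)
  show "\<exists>p q. P = Complex p q" by (metis complex.collapse)
  have "nonzero_divisor (Complex p q) \<longleftrightarrow> Complex p q \<noteq> 0"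
    by (auto simp: nonzero_divisor_def intro: exI[of _ 1])
  also have "\<dots> \<longleftrightarrow> p\<^sup>2 - (-1) * q\<^sup>2 \<noteq> 0"
    by (simp add: complex_eq_iff sum_power2_eq_zero_iff)
  finally show "nonzero_divisor (Complex p q) \<longleftrightarrow> p\<^sup>2 - (-1) * q\<^sup>2 \<noteq> 0" .
qed

lemma elliptic_complex: "elliptic (line_family complex_mat)"
proof -
  let ?g = "\<lambda>i::2. if i = 1 then 1 else - \<i>"
  have "{v. cmat complex_op *v v = \<i> *s v} = range (\<lambda>y :: complex^3. (\<chi> r. ?g (snd r) * y $ fst r) :: C6)"
  proof (intro subset_antisym subsetI)
    fix v assume v: "v \<in> {v. cmat complex_op *v v = \<i> *s v}"
    have "v $ (k, 2) = - \<i> * v $ (k, 1)" for k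
    proof -
      have "(cmat complex_op *v v) $ (k, 1) = \<i> * v $ (k, 1)" using v by simp
      then have "- v $ (k, 2) = \<i> * v $ (k, 1)"
        unfolding cmat_block_op_apply complex_mat_nth by simp
      then show ?thesis by (metis minus_minus mult_minus_left)
    qed
    then have "v = (\<chi> r. ?g (snd r) * (\<chi> k. v $ (k, 1)) $ fst r)"
      by (simp add: vec_3_2_eq_iff)
    then show "v \<in> range (\<lambda>y :: complex^3. (\<chi> r. ?g (snd r) * y $ fst r) :: C6)" by (rule range_eqI)
  qed (auto simp: vec_3_2_eq_iff cmat_block_op_apply complex_mat_nth)
  then have "vec.dim {v. cmat complex_op *v v = \<i> *s v} = 3"
    using dim_graph[of ?g 1] by simp
  then show ?thesis unfolding complex.line_family_eq by (intro complex.elliptic_K) simp_all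
qed

subsection \<open>Double numbers\<close>

lemma double_mat_nth:
  "double_mat z $ 1 $ 1 = db_re z" "double_mat z $ 1 $ 2 = db_im z"
  "double_mat z $ 2 $ 1 = db_im z" "double_mat z $ 2 $ 2 = db_re z"
  by (simp_all add: double_mat_def)

abbreviation double_op where "double_op \<equiv> block_op (double_mat (DoubleN 0 1))"

lemma double_op_apply:
  "(double_op *v x) $ (k, 1) = x $ (k, 2)" "(double_op *v x) $ (k, 2) = x $ (k, 1)"
  by (simp_all add: block_op_apply double_mat_nth)

lemma double_op_square: "double_op *v (double_op *v x) = x"
  by (simp add: vec_3_2_eq_iff double_op_apply)

lemma dim_double_eigenspaces:
  "dim {v. double_op *v v = v} = 3" "dim {v. double_op *v v = - v} = 3"
proof -
  have "dim {v. double_op *v v = e *\<^sub>R v} = 3" if e: "e * e = 1" for e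
  proof -
    let ?g = "\<lambda>i::2. if i = 1 then 1 else e"
    have "{v. double_op *v v = e *\<^sub>R v} = range (\<lambda>y :: real^3. (\<chi> r. ?g (snd r) * y $ fst r) :: R6)"
    proof (intro subset_antisym subsetI)
      fix v assume v: "v \<in> {v. double_op *v v = e *\<^sub>R v}"
      have "v $ (k, 2) = e * v $ (k, 1)" for k
        using v double_op_apply(1)[of v k] by simp
      then have "v = (\<chi> r. ?g (snd r) * (\<chi> k. v $ (k, 1)) $ fst r)"
        by (simp add: vec_3_2_eq_iff)
      then show "v \<in> range (\<lambda>y :: real^3. (\<chi> r. ?g (snd r) * y $ fst r) :: R6)" by (rule range_eqI)
    qed (use e in \<open>auto simp: vec_3_2_eq_iff double_op_apply simp flip: mult.assoc\<close>)
    then show ?thesis using dim_graph[of ?g 1] by (simp add: dim_vec_eq)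
  qed
  from this[of 1] this[of "-1"] show
    "dim {v. double_op *v v = v} = 3" "dim {v. double_op *v v = - v} = 3" by simp_all
qed

interpretation double: algebra_representation double_op 1 double_mat DoubleN
proof
  fix X Y :: "double_num^3" and x :: R6 and p q :: real and P
  show "double_op *v (double_op *v x) = 1 *\<^sub>R x" by (simp add: double_op_square)
  show "free_quotient double_op x"
    by (rule free_quotient_involution[OF double_op_square dim_double_eigenspaces])
  show "column 2 (point_mat double_mat X) = double_op *v column 1 (point_mat double_mat X)"
    by (simp add: vec_3_2_eq_iff double_op_apply column_1_point_mat column_2_point_mat double_mat_nth)
  show "\<exists>X. column 1 (point_mat double_mat X) = x"
    by (rule exI[of _ "\<chi> k. DoubleN (x $ (k, 1)) (x $ (k, 2))"])
      (simp add: vec_3_2_eq_iff column_1_point_mat double_mat_nth)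
  show "X = Y" if "column 1 (point_mat double_mat X) = column 1 (point_mat double_mat Y)"
    using that by (simp add: vec_3_2_eq_iff column_1_point_mat double_mat_nth vec_eq_iff double_num.expand)
  show "column 1 (point_mat double_mat (\<chi> k. X $ k * DoubleN p q)) =
      p *\<^sub>R column 1 (point_mat double_mat X) + q *\<^sub>R (double_op *v column 1 (point_mat double_mat X))"
    by (simp add: vec_3_2_eq_iff double_op_apply column_1_point_mat double_mat_nth times_double_num_def
        algebra_simps)
  show "\<exists>p q. P = DoubleN p q" by (metis double_num.collapse)
  have "nonzero_divisor (DoubleN p q) \<longleftrightarrow> DoubleN (p\<^sup>2 - q\<^sup>2) 0 \<noteq> 0"
  proof (rule nonzero_divisor_iff_unit)
    show "DoubleN p q * DoubleN p (- q) = DoubleN (p\<^sup>2 - q\<^sup>2) 0"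
      by (simp add: times_double_num_def power2_eq_square)
    assume "DoubleN (p\<^sup>2 - q\<^sup>2) 0 \<noteq> 0"
    then have "DoubleN (inverse (p\<^sup>2 - q\<^sup>2)) 0 * DoubleN (p\<^sup>2 - q\<^sup>2) 0 = 1"
      by (simp add: times_double_num_def zero_double_num_def one_double_num_def)
    then show "\<exists>u. u * DoubleN (p\<^sup>2 - q\<^sup>2) 0 = 1" ..
  qed (simp add: zero_double_num_def)
  then show "nonzero_divisor (DoubleN p q) \<longleftrightarrow> p\<^sup>2 - 1 * q\<^sup>2 \<noteq> 0"
    by (simp add: zero_double_num_def)
qed

lemma hyperbolic_double: "hyperbolic (line_family double_mat)"
  unfolding double.line_family_eq by (rule double.hyperbolic_K[OF refl dim_double_eigenspaces])

subsection \<open>Dual numbers\<close>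

lemma dual_mat_nth:
  "dual_mat z $ 1 $ 1 = du_re z" "dual_mat z $ 1 $ 2 = 0"
  "dual_mat z $ 2 $ 1 = du_im z" "dual_mat z $ 2 $ 2 = du_re z"
  by (simp_all add: dual_mat_def)

abbreviation dual_op where "dual_op \<equiv> block_op (dual_mat (DualN 0 1))"

lemma dual_op_apply:
  "(dual_op *v x) $ (k, 1) = 0" "(dual_op *v x) $ (k, 2) = x $ (k, 1)"
  by (simp_all add: block_op_apply dual_mat_nth)

lemma dual_op_square: "dual_op *v (dual_op *v x) = 0"
  by (simp add: vec_3_2_eq_iff dual_op_apply)

lemma dual_op_kernel: "dual_op *v v = 0 \<longleftrightarrow> (\<exists>x. v = dual_op *v x)"
proof
  assume "dual_op *v v = 0"
  then have "v = dual_op *v (\<chi> r. v $ (fst r, 2))"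
    by (simp add: vec_3_2_eq_iff dual_op_apply)
  then show "\<exists>x. v = dual_op *v x" ..
qed (auto simp: dual_op_square)

lemma dim_dual_op_kernel: "dim {v. dual_op *v v = 0} = 3"
proof -
  let ?g = "\<lambda>i::2. if i = 1 then 0 else 1 :: real"
  have "{v. dual_op *v v = 0} = range (\<lambda>y :: real^3. (\<chi> r. ?g (snd r) * y $ fst r) :: R6)"
  proof (intro subset_antisym subsetI)
    fix v assume "v \<in> {v. dual_op *v v = 0}"
    then have "v = (\<chi> r. ?g (snd r) * (\<chi> k. v $ (k, 2)) $ fst r)"
      by (simp add: vec_3_2_eq_iff dual_op_apply)
    then show "v \<in> range (\<lambda>y :: real^3. (\<chi> r. ?g (snd r) * y $ fst r) :: R6)" by (rule range_eqI)
  qed (auto simp: vec_3_2_eq_iff dual_op_apply)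
  then show ?thesis using dim_graph[of ?g 2] by (simp add: dim_vec_eq)
qed

interpretation dual: algebra_representation dual_op 0 dual_mat DualN
proof
  fix X Y :: "dual_num^3" and x :: R6 and p q :: real and P
  show "dual_op *v (dual_op *v x) = 0 *\<^sub>R x" by (simp add: dual_op_square)
  have "range ((*v) dual_op) = {v. dual_op *v v = 0}" using dual_op_kernel by auto
  then show "free_quotient dual_op x" if "lin_pair x (dual_op *v x)"
    using lin_pairD[OF that, of 0 1] dim_dual_op_kernel dual_op_square
    by (intro free_quotient_nilpotent) auto
  show "column 2 (point_mat dual_mat X) = dual_op *v column 1 (point_mat dual_mat X)"
    by (simp add: vec_3_2_eq_iff dual_op_apply column_1_point_mat column_2_point_mat dual_mat_nth)
  show "\<exists>X. column 1 (point_mat dual_mat X) = x"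
    by (rule exI[of _ "\<chi> k. DualN (x $ (k, 1)) (x $ (k, 2))"])
      (simp add: vec_3_2_eq_iff column_1_point_mat dual_mat_nth)
  show "X = Y" if "column 1 (point_mat dual_mat X) = column 1 (point_mat dual_mat Y)"
    using that by (simp add: vec_3_2_eq_iff column_1_point_mat dual_mat_nth vec_eq_iff dual_num.expand)
  show "column 1 (point_mat dual_mat (\<chi> k. X $ k * DualN p q)) =
      p *\<^sub>R column 1 (point_mat dual_mat X) + q *\<^sub>R (dual_op *v column 1 (point_mat dual_mat X))"
    by (simp add: vec_3_2_eq_iff dual_op_apply column_1_point_mat dual_mat_nth times_dual_num_def
        algebra_simps)
  show "\<exists>p q. P = DualN p q" by (metis dual_num.collapse)
  have "nonzero_divisor (DualN p q) \<longleftrightarrow> DualN (p\<^sup>2) 0 \<noteq> 0"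
  proof (rule nonzero_divisor_iff_unit)
    show "DualN p q * DualN p (- q) = DualN (p\<^sup>2) 0"
      by (simp add: times_dual_num_def power2_eq_square)
    assume "DualN (p\<^sup>2) 0 \<noteq> 0"
    then have "DualN (inverse (p\<^sup>2)) 0 * DualN (p\<^sup>2) 0 = 1"
      by (simp add: times_dual_num_def zero_dual_num_def one_dual_num_def)
    then show "\<exists>u. u * DualN (p\<^sup>2) 0 = 1" ..
  qed (simp add: zero_dual_num_def)
  then show "nonzero_divisor (DualN p q) \<longleftrightarrow> p\<^sup>2 - 0 * q\<^sup>2 \<noteq> 0"
    by (simp add: zero_dual_num_def)
qed

lemma parabolic_dual: "parabolic (line_family dual_mat)"
  unfolding dual.line_family_eq
  by (rule dual.parabolic_K[OF refl dim_dual_op_kernel]) (simp add: dual_op_kernel)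

theorem theorem1:
  shows "(column_line complex_mat respects point_rel complex_mat \<and>
          bij_betw (point_line complex_mat) (proj_plane complex_mat) (line_family complex_mat) \<and>
          elliptic (line_family complex_mat)) \<and>
         (column_line double_mat respects point_rel double_mat \<and>
          bij_betw (point_line double_mat) (proj_plane double_mat) (line_family double_mat) \<and>
          hyperbolic (line_family double_mat)) \<and>
         (column_line dual_mat respects point_rel dual_mat \<and>
          bij_betw (point_line dual_mat) (proj_plane dual_mat) (line_family dual_mat) \<and>
          parabolic (line_family dual_mat))"
  by (intro conjI complex.column_line_respects double.column_line_respects dual.column_line_respects
      complex.point_line_bij double.point_line_bij dual.point_line_bij
      elliptic_complex hyperbolic_double parabolic_dual)

end
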